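(* Let $(A,d,h)$ be a CDG Lie algebra over $\mathbb{C}$ and let $M^\bullet$ be a left CDG-module over it. Let $C^{\bullet\bullet}(A,M^\bullet)$ be the associated bigraded space of cochains, with the operators $d_1$ and $d_2$ defined in the context. Then the operator $D=d_1+d_2$, which has degree $1$ for the total grading, satisfies $D^2=0$.
   Context: All gradings are $\mathbb{Z}$-gradings, parity is degree mod 2, and the Koszul sign rule is used. A CDG Lie algebra (differential graded Lie superalgebra with curvature) is a triple $(A,d,h)$: $A=\bigoplus_k A_k$ is a graded Lie superalgebra over $\mathbb{C}$; $d:A_k\to A_{k+1}$ is a derivation of degree 1, i.e. $d[a,b]=[da,b]+(-1)^{|a|}[a,db]$; and $h\in A_2$ satisfies $d^2(a)=[h,a]$ for all $a\in A$ and $d(h)=0$. It is not required that $d^2=0$. A left CDG-module over it is a graded left module $M^\bullet=\bigoplus_k M^k$ over the graded Lie superalgebra $A$ (so $A_i\cdot M^j\subset M^{i+j}$ and $[a,b]m=a(bm)-(-1)^{|a||b|}b(am)$) with a map $d_M:M^k\to M^{k+1}$ such that $d_M(am)=(da)m+(-1)^{|a|}a\,d_M m$ and $d_M^2(m)=h\cdot m$. Cochains. Let $sA$ be the graded space with elements $sa$, $a\in A$, where $|sa|=|a|-1$. The super exterior power $\Lambda^p(A)$ is identified, up to a shift of degree, with the graded-symmetric power $\mathrm{Sym}^p(sA)$. Let $C^{p,k}(A,M^\bullet)$ be the space of $p$-linear graded-symmetric maps $f:(sA)^p\to M^\bullet$ such that $f(sa_1,\dots,sa_p)\in M^{k+\sum_i|a_i|}$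 for homogeneous $a_i$. The total degree of such $f$ is $n=p+k$, and the total space is graded by $C^n=\bigoplus_{p+k=n}C^{p,k}$. For $x_i=sa_i$ put $\eta_i=(-1)^{|x_i|(|x_1|+\dots+|x_{i-1}|)}$, and let $\eta_{ij}=\pm1$ ($i<j$) be the Koszul sign of moving $x_i,x_j$ (in this order) to the front of $x_1\cdots x_m$. For $f$ of total degree $n$, the operator $d_1$ is the sum of the internal and Chevalley differentials, $d_1=d_{\mathrm{int}}+d_{\mathrm{Ch}}$: $$(d_{\mathrm{int}}f)(x_1,\dots,x_m)=d_M\big(f(x_1,\dots,x_m)\big)+(-1)^n\sum_i(-1)^{|x_1|+\dots+|x_{i-1}|}f(x_1,\dots,s(da_i),\dots,x_m),$$ $$(d_{\mathrm{Ch}}f)(x_1,\dots,x_m)=\sum_i(-1)^{n|x_i|}\eta_i\,a_i\cdot f(x_1,\dots,\widehat{x_i},\dots,x_m)-(-1)^n\sum_{i<j}\eta_{ij}(-1)^{|a_i|}f(s[a_i,a_j],x_1,\dots,\widehat{x_i},\dots,\widehat{x_j},\dots,x_m).$$ The operator $d_2$, of bidegree $(-1,2)$, is given by the curvature: $$(d_2f)(x_1,\dots,x_{m-1})=(-1)^n f(sh,x_1,\dots,x_{m-1}).$$ *)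

theory Defs
  imports Complex_Main
begin

abbreviation ksign :: "int \<Rightarrow> complex" where
  "ksign k \<equiv> (-1) powi k"

text \<open>A \<open>\<int>\<close>-graded complex vector space is a whole type \<open>'v\<close> with a scalar multiplication
  and subspaces \<open>gr k\<close> of which \<open>'v\<close> is the (algebraic) direct sum.\<close>

definition is_decomposition :: "(int \<Rightarrow> 'v::ab_group_add set) \<Rightarrow> 'v \<Rightarrow> (int \<Rightarrow> 'v) \<Rightarrow> bool" where
  "is_decomposition gr v c \<longleftrightarrow>
     (\<forall>k. c k \<in> gr k) \<and> finite {k. c k \<noteq> 0} \<and> v = (\<Sum>k | c k \<noteq> 0. c k)"

locale graded_space = vector_space scale
  for scale :: "complex \<Rightarrow> 'v::ab_group_add \<Rightarrow> 'v" +
  fixes gr :: "int \<Rightarrow> 'v set"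
  assumes subspace_gr: "subspace (gr k)"
    and direct_sum: "\<exists>!c. is_decomposition gr v c"

definition component :: "(int \<Rightarrow> 'v::ab_group_add set) \<Rightarrow> 'v \<Rightarrow> int \<Rightarrow> 'v" where
  "component gr v = (THE c. is_decomposition gr v c)"

definition degrees :: "(int \<Rightarrow> 'v::ab_group_add set) \<Rightarrow> 'v \<Rightarrow> int set" where
  "degrees gr v = {k. component gr v k \<noteq> 0}"

lemma (in graded_space) component_homogeneous:
  assumes "v \<in> gr k"
  shows "component gr v = (\<lambda>i. if i = k then v else 0)"
proof -
  have "0 \<in> gr i" for i
    using subspace_gr subspace_0 by blast
  moreover have "{i. (if i = k then v else 0) \<noteq> 0} = (if v = 0 then {} else {k})"
    by auto
  ultimately have "is_decomposition gr v (\<lambda>i. if i = k then v else 0)"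
    using assms by (simp add: is_decomposition_def)
  then show ?thesis
    unfolding component_def using direct_sum by (intro the1_equality)
qed


record 'a cdg_lie_data =
  scl :: "complex \<Rightarrow> 'a \<Rightarrow> 'a"
  gr :: "int \<Rightarrow> 'a set"
  brk :: "'a \<Rightarrow> 'a \<Rightarrow> 'a"
  dif :: "'a \<Rightarrow> 'a"
  crv :: "'a"

locale cdg_lie_algebra = graded_space "scl A" "gr A"
  for A :: "'a::ab_group_add cdg_lie_data" +
  assumes brk_linear_left: "Vector_Spaces.linear (scl A) (scl A) (\<lambda>a. brk A a b)"
    and brk_linear_right: "Vector_Spaces.linear (scl A) (scl A) (\<lambda>b. brk A a b)"
    and brk_degree: "a \<in> gr A i \<Longrightarrow> b \<in> gr A j \<Longrightarrow> brk A a b \<in> gr A (i + j)"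
    and brk_skew: "a \<in> gr A i \<Longrightarrow> b \<in> gr A j \<Longrightarrow>
      brk A a b = - scl A (ksign (i * j)) (brk A b a)"
    and brk_jacobi: "a \<in> gr A i \<Longrightarrow> b \<in> gr A j \<Longrightarrow> c \<in> gr A k \<Longrightarrow>
      brk A a (brk A b c) = brk A (brk A a b) c + scl A (ksign (i * j)) (brk A b (brk A a c))"
    and dif_linear: "Vector_Spaces.linear (scl A) (scl A) (dif A)"
    and dif_degree: "a \<in> gr A i \<Longrightarrow> dif A a \<in> gr A (i + 1)"
    and dif_derivation: "a \<in> gr A i \<Longrightarrow> b \<in> gr A j \<Longrightarrow>
      dif A (brk A a b) = brk A (dif A a) b + scl A (ksign i) (brk A a (dif A b))"
    and crv_degree: "crv A \<in> gr A 2"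
    and dif_dif: "dif A (dif A a) = brk A (crv A) a"
    and dif_crv: "dif A (crv A) = 0"

record ('a, 'm) cdg_module_data =
  mscl :: "complex \<Rightarrow> 'm \<Rightarrow> 'm"
  mgr :: "int \<Rightarrow> 'm set"
  act :: "'a \<Rightarrow> 'm \<Rightarrow> 'm"
  mdif :: "'m \<Rightarrow> 'm"

locale cdg_module = cdg_lie_algebra A + M: graded_space "mscl M" "mgr M"
  for A :: "'a::ab_group_add cdg_lie_data"
    and M :: "('a, 'm::ab_group_add) cdg_module_data" +
  assumes act_linear_left: "Vector_Spaces.linear (scl A) (mscl M) (\<lambda>a. act M a m)"
    and act_linear_right: "Vector_Spaces.linear (mscl M) (mscl M) (\<lambda>m. act M a m)"
    and act_degree: "a \<in> gr A i \<Longrightarrow> m \<in> mgr M j \<Longrightarrow> act M a m \<in> mgr M (i + j)"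
    and act_brk: "a \<in> gr A i \<Longrightarrow> b \<in> gr A j \<Longrightarrow>
      act M (brk A a b) m = act M a (act M b m) - mscl M (ksign (i * j)) (act M b (act M a m))"
    and mdif_linear: "Vector_Spaces.linear (mscl M) (mscl M) (mdif M)"
    and mdif_degree: "m \<in> mgr M k \<Longrightarrow> mdif M m \<in> mgr M (k + 1)"
    and mdif_act: "a \<in> gr A i \<Longrightarrow>
      mdif M (act M a m) = act M (dif A a) m + mscl M (ksign i) (act M a (mdif M m))"
    and mdif_mdif: "mdif M (mdif M m) = act M (crv A) m"


text \<open>The element \<open>sa\<close> of \<open>sA\<close> is represented by \<open>a\<close> itself; the shift shows only in the degree
  \<open>\<bar>sa\<bar> = \<bar>a\<bar> - 1\<close> used in the signs. A map \<open>(sA)\<^sup>p \<rightarrow> M\<close> is a function on lists which vanishes on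
  lists of any length other than \<open>p\<close>. A list \<open>ks\<close> accompanying a list \<open>xs\<close> of homogeneous elements
  always contains the degrees in \<open>A\<close>, and lists are indexed from \<open>0\<close>.\<close>

definition homogeneous :: "'a::ab_group_add cdg_lie_data \<Rightarrow> int list \<Rightarrow> 'a list \<Rightarrow> bool" where
  "homogeneous A ks xs \<longleftrightarrow> list_all2 (\<lambda>k x. x \<in> gr A k) ks xs"

definition multilinear ::
  "'a::ab_group_add cdg_lie_data \<Rightarrow> ('a, 'm::ab_group_add) cdg_module_data \<Rightarrow> nat
    \<Rightarrow> ('a list \<Rightarrow> 'm) \<Rightarrow> bool" where
  "multilinear A M p f \<longleftrightarrow> (\<forall>xs i. length xs = p \<and> i < p \<longrightarrow>
     Vector_Spaces.linear (scl A) (mscl M) (\<lambda>v. f (xs[i := v])))"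

text \<open>Graded symmetry is imposed for adjacent transpositions, which generate the symmetric group.\<close>

definition graded_symmetric ::
  "'a::ab_group_add cdg_lie_data \<Rightarrow> ('a, 'm::ab_group_add) cdg_module_data
    \<Rightarrow> ('a list \<Rightarrow> 'm) \<Rightarrow> bool" where
  "graded_symmetric A M f \<longleftrightarrow> (\<forall>us vs x y i j. x \<in> gr A i \<and> y \<in> gr A j \<longrightarrow>
     f (us @ [x, y] @ vs) = mscl M (ksign ((i - 1) * (j - 1))) (f (us @ [y, x] @ vs)))"

definition cochains ::
  "'a::ab_group_add cdg_lie_data \<Rightarrow> ('a, 'm::ab_group_add) cdg_module_data \<Rightarrow> nat \<Rightarrow> int
    \<Rightarrow> ('a list \<Rightarrow> 'm) set" where
  "cochains A M p k = {f. (\<forall>xs. length xs \<noteq> p \<longrightarrow> f xs = 0) \<and> multilinear A M p f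
     \<and> graded_symmetric A M f
     \<and> (\<forall>ks xs. length xs = p \<and> homogeneous A ks xs \<longrightarrow> f xs \<in> mgr M (k + sum_list ks))}"

text \<open>The differentials are given by formulas \<open>\<phi> ks xs\<close> on homogeneous arguments \<open>xs\<close> of degrees
  \<open>ks\<close>. They are extended to all arguments by splitting each argument into its homogeneous
  components.\<close>

definition extend :: "'a::ab_group_add cdg_lie_data \<Rightarrow> (int list \<Rightarrow> 'a list \<Rightarrow> 'm::ab_group_add)
    \<Rightarrow> 'a list \<Rightarrow> 'm" where
  "extend A \<phi> xs =
     (\<Sum>ks\<in>listset (map (degrees (gr A)) xs). \<phi> ks (map2 (component (gr A)) xs ks))"

lemma (in cdg_lie_algebra) extend_homogeneous:
  assumes "homogeneous A ks xs" and "0 \<notin> set xs"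
  shows "extend A \<phi> xs = \<phi> ks xs"
proof -
  have "listset (map (degrees (gr A)) xs) = {ks} \<and> map2 (component (gr A)) xs ks = xs"
    using assms unfolding homogeneous_def
  proof (induction rule: list_all2_induct)
    case (Cons k ks x xs)
    then have "degrees (gr A) x = {k}" "component (gr A) x k = x"
      by (auto simp: degrees_def component_homogeneous)
    with Cons show ?case
      by (simp add: set_Cons_def)
  qed simp
  then show ?thesis
    by (simp add: extend_def)
qed

definition omit :: "nat \<Rightarrow> 'b list \<Rightarrow> 'b list" where
  "omit i xs = take i xs @ drop (Suc i) xs"

definition sdeg :: "int list \<Rightarrow> nat \<Rightarrow> int" where
  "sdeg ks i = ks ! i - 1"

definition eta1 :: "int list \<Rightarrow> nat \<Rightarrow> complex" where
  "eta1 ks i = ksign (sdeg ks i * (\<Sum>l<i. sdeg ks l))"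

text \<open>For \<open>i < j\<close>, the sign of moving the entries \<open>i\<close> and \<open>j\<close>, in this order, to the front: entry
  \<open>j\<close> passes every earlier entry except entry \<open>i\<close>.\<close>

definition eta2 :: "int list \<Rightarrow> nat \<Rightarrow> nat \<Rightarrow> complex" where
  "eta2 ks i j =
     ksign (sdeg ks i * (\<Sum>l<i. sdeg ks l) + sdeg ks j * (\<Sum>l\<in>{..<j} - {i}. sdeg ks l))"

text \<open>In the next three definitions \<open>n\<close> is the total degree of the cochain \<open>f\<close>.\<close>

definition d_int :: "'a::ab_group_add cdg_lie_data \<Rightarrow> ('a, 'm::ab_group_add) cdg_module_data
    \<Rightarrow> int \<Rightarrow> ('a list \<Rightarrow> 'm) \<Rightarrow> 'a list \<Rightarrow> 'm" where
  "d_int A M n f = extend A (\<lambda>ks xs.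
     mdif M (f xs)
     + mscl M (ksign n)
         (\<Sum>i<length xs. mscl M (ksign (\<Sum>l<i. sdeg ks l)) (f (xs[i := dif A (xs ! i)]))))"

definition d_Ch :: "'a::ab_group_add cdg_lie_data \<Rightarrow> ('a, 'm::ab_group_add) cdg_module_data
    \<Rightarrow> int \<Rightarrow> ('a list \<Rightarrow> 'm) \<Rightarrow> 'a list \<Rightarrow> 'm" where
  "d_Ch A M n f = extend A (\<lambda>ks xs.
     (\<Sum>i<length xs.
        mscl M (ksign (n * sdeg ks i) * eta1 ks i) (act M (xs ! i) (f (omit i xs))))
     - mscl M (ksign n)
         (\<Sum>j<length xs. \<Sum>i<j.
            mscl M (eta2 ks i j * ksign (ks ! i))
              (f (brk A (xs ! i) (xs ! j) # omit i (omit j xs)))))"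

definition d_crv :: "'a::ab_group_add cdg_lie_data \<Rightarrow> ('a, 'm::ab_group_add) cdg_module_data
    \<Rightarrow> int \<Rightarrow> ('a list \<Rightarrow> 'm) \<Rightarrow> 'a list \<Rightarrow> 'm" where
  "d_crv A M n f xs = mscl M (ksign n) (f (crv A # xs))"


text \<open>An element of the total space \<open>\<Oplus>\<^bsub>p,k\<^esub> C\<^bsup>p,k\<^esup>\<close> is the family \<open>F\<close> of its components \<open>F p k\<close>.\<close>

type_synonym ('a, 'm) cochain_family = "nat \<Rightarrow> int \<Rightarrow> 'a list \<Rightarrow> 'm"

definition total_space ::
  "'a::ab_group_add cdg_lie_data \<Rightarrow> ('a, 'm::ab_group_add) cdg_module_data
    \<Rightarrow> ('a, 'm) cochain_family set" where
  "total_space A M =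
     {F. (\<forall>p k. F p k \<in> cochains A M p k) \<and> finite {(p, k). F p k \<noteq> (\<lambda>_. 0)}}"

definition total_degree_part ::
  "'a::ab_group_add cdg_lie_data \<Rightarrow> ('a, 'm::ab_group_add) cdg_module_data \<Rightarrow> int
    \<Rightarrow> ('a, 'm) cochain_family set" where
  "total_degree_part A M n =
     {F \<in> total_space A M. \<forall>p k. int p + k \<noteq> n \<longrightarrow> F p k = (\<lambda>_. 0)}"

text \<open>The \<open>(p, k)\<close>-component of \<open>d\<^sub>1 F\<close> receives \<open>F p (k - 1)\<close> through the internal differential,
  of bidegree \<open>(0, 1)\<close>, and \<open>F (p - 1) k\<close> through the Chevalley differential, of bidegree \<open>(1, 0)\<close>.\<close>

definition D1 ::
  "'a::ab_group_add cdg_lie_data \<Rightarrow> ('a, 'm::ab_group_add) cdg_module_data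
    \<Rightarrow> ('a, 'm) cochain_family \<Rightarrow> ('a, 'm) cochain_family" where
  "D1 A M F p k xs =
     d_int A M (int p + (k - 1)) (F p (k - 1)) xs
     + (case p of 0 \<Rightarrow> 0 | Suc q \<Rightarrow> d_Ch A M (int q + k) (F q k) xs)"

definition D2 ::
  "'a::ab_group_add cdg_lie_data \<Rightarrow> ('a, 'm::ab_group_add) cdg_module_data
    \<Rightarrow> ('a, 'm) cochain_family \<Rightarrow> ('a, 'm) cochain_family" where
  "D2 A M F p k xs = d_crv A M (int (p + 1) + (k - 2)) (F (p + 1) (k - 2)) xs"

definition D ::
  "'a::ab_group_add cdg_lie_data \<Rightarrow> ('a, 'm::ab_group_add) cdg_module_data
    \<Rightarrow> ('a, 'm) cochain_family \<Rightarrow> ('a, 'm) cochain_family" where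
  "D A M F p k xs = D1 A M F p k xs + D2 A M F p k xs"

end

theory Submission
  imports Defs
begin

text \<open>
  Write \<open>x = sa\<close>, and let \<open>f\<close> be a graded-symmetric form on \<open>sA\<close> of total degree \<open>n\<close>, seen as one
  function on lists of all lengths. The proof of \<open>D\<^sup>2 = 0\<close> is a Cartan calculus for the contractions
  \<open>(\<iota>\<^sub>x f)(x\<^sub>1, \<dots>) = f(x, x\<^sub>1, \<dots>)\<close>. Splitting off the terms of \<open>D f\<close> in which the first argument takes
  part gives \<open>\<iota>\<^sub>x D f = D \<iota>\<^sub>x f + L\<^sub>x f\<close> with the Lie derivative
  \<open>L\<^sub>x f = (-1)\<^sup>n \<iota>\<^bsub>s(da)\<^esub> f + (-1)\<^bsup>n|x|\<^esup> a \<cdot> f + (-1)\<^bsup>n+|x|\<^esup> \<Sigma>\<^sub>j \<plusminus> f(\<dots>, s[a, a\<^sub>j], \<dots>)\<close>.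
  The curvature contributes nothing to \<open>L\<^sub>x\<close>, because \<open>sh\<close> is odd and moves past \<open>x\<close> with exactly the sign by
  which \<open>(-1)\<^sup>n\<close> changes when \<open>f\<close> is contracted. Since contractions shorten the argument list, this
  equation determines \<open>D\<close> recursively from its value \<open>d\<^sub>M f() + (-1)\<^sup>n f(sh)\<close> on the empty list.

  Every identity now follows by induction on the argument list, in the order
  \<^item> \<open>\<iota>\<^sub>y L\<^sub>x f = \<plusminus> L\<^sub>x \<iota>\<^sub>y f \<plusminus> \<iota>\<^bsub>s[a,b]\<^esub> f\<close> (\<open>lie_der_Cons\<close>);
  \<^item> \<open>L\<^sub>y L\<^sub>x f \<plusminus> L\<^sub>x L\<^sub>y f = \<plusminus> L\<^bsub>s[a,b]\<^esub> f\<close> (\<open>lie_commutator\<close>), where the step is the Jacobi identity and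
    the empty list needs that \<open>d\<close> is a derivation and that \<open>M\<close> is a module;
  \<^item> \<open>D L\<^sub>x f + L\<^sub>x D f = 0\<close> (\<open>cartan_dif_lie_der\<close>), where the step is the previous identity and the empty
    list needs \<open>d\<^sup>2 a = [h, a]\<close> and the Leibniz rule of \<open>d\<^sub>M\<close>;
  \<^item> \<open>D\<^sup>2 f = 0\<close> (\<open>cartan_dif_square\<close>): one has \<open>\<iota>\<^sub>x D\<^sup>2 f = D\<^sup>2 \<iota>\<^sub>x f + (D L\<^sub>x f + L\<^sub>x D f)\<close>, and on the empty
    list what remains is \<open>d\<^sub>M\<^sup>2 m = h m\<close>, \<open>dh = 0\<close> and \<open>f(sh, sh) = 0\<close>, the last because \<open>sh\<close> is odd.

  It remains to compare the recursive operator with the defining sums (\<open>cartan_dif_explicit\<close>) and to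
  pass from homogeneous arguments to arbitrary ones. For the latter, a symmetric form on homogeneous
  arguments has one multilinear extension, and \<open>D\<close> on the total space is the extension of the
  recursive operator (\<open>D_extend_form\<close>).
\<close>

section \<open>Koszul signs\<close>

text \<open>Letting signs act on an arbitrary abelian group turns every sign identity below into a case
  distinction on the parities of the degrees, with no scalars involved.\<close>

definition koszul :: "int \<Rightarrow> 'v::ab_group_add \<Rightarrow> 'v" where
  "koszul k v = (if even k then v else - v)"

lemma koszul_add [simp]: "koszul k (u + v) = koszul k u + koszul k v"
  and koszul_minus [simp]: "koszul k (- u) = - koszul k u"
  and koszul_diff [simp]: "koszul k (u - v) = koszul k u - koszul k v"
  and koszul_zero [simp]: "koszul k (0 :: 'v::ab_group_add) = 0"
  and koszul_koszul [simp]: "koszul k (koszul l u) = koszul (k + l) u"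
  by (auto simp: koszul_def)

lemma koszul_0 [simp]: "koszul 0 v = v"
  by (simp add: koszul_def)

lemma koszul_sum: "koszul k (\<Sum>i\<in>I. g i) = (\<Sum>i\<in>I. koszul k (g i))"
  by (simp add: koszul_def sum_negf)

lemma ksign_eq: "ksign k = (if even k then 1 else - 1)"
  by (simp add: power_int_minus_left)

lemma (in module_hom) koszul: "f (koszul k v) = koszul k (f v)"
  by (simp add: koszul_def neg)

lemma (in vector_space) scale_koszul: "scale c (koszul k v) = koszul k (scale c v)"
  by (simp add: koszul_def)

lemma (in vector_space) scale_sign: "scale (if even k then 1 else - 1) v = koszul k v"
  by (simp add: koszul_def)

section \<open>Symmetric forms on homogeneous arguments\<close>

context cdg_module
begin

lemmas brk_left = brk_linear_left[unfolded linear_iff_module_hom]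
lemmas brk_right = brk_linear_right[unfolded linear_iff_module_hom]
lemmas dif_hom = dif_linear[unfolded linear_iff_module_hom]
lemmas act_left = act_linear_left[unfolded linear_iff_module_hom]
lemmas act_right = act_linear_right[unfolded linear_iff_module_hom]
lemmas mdif_hom = mdif_linear[unfolded linear_iff_module_hom]

lemmas linear_simps =
  module_hom.add[OF brk_left] module_hom.scale[OF brk_left] module_hom.zero[OF brk_left]
  module_hom.add[OF brk_right] module_hom.scale[OF brk_right] module_hom.zero[OF brk_right]
  module_hom.add[OF dif_hom] module_hom.scale[OF dif_hom] module_hom.zero[OF dif_hom]
  module_hom.add[OF act_left] module_hom.scale[OF act_left] module_hom.zero[OF act_left]
  module_hom.koszul[OF act_left]
  module_hom.add[OF act_right] module_hom.scale[OF act_right] module_hom.zero[OF act_right]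
  module_hom.koszul[OF act_right]
  module_hom.add[OF mdif_hom] module_hom.scale[OF mdif_hom] module_hom.zero[OF mdif_hom]
  module_hom.koszul[OF mdif_hom]
  M.scale_koszul scale_koszul

lemma mscl_ksign: "mscl M (ksign k) m = koszul k m"
  by (simp only: ksign_eq M.scale_sign)

lemma scl_ksign: "scl A (ksign k) a = koszul k a"
  by (simp only: ksign_eq scale_sign)

text \<open>Arguments carry a degree label, since \<open>0\<close> belongs to every degree and the signs must not
  depend on a choice.\<close>
definition hom :: "int \<times> 'a \<Rightarrow> bool" where
  "hom z \<longleftrightarrow> snd z \<in> gr A (fst z)"

abbreviation homs :: "(int \<times> 'a) list \<Rightarrow> bool" where
  "homs \<equiv> list_all hom"

text \<open>The degree of the suspension.\<close>
abbreviation sdg :: "int \<times> 'a \<Rightarrow> int" where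
  "sdg z \<equiv> fst z - 1"

definition hdif :: "int \<times> 'a \<Rightarrow> int \<times> 'a" where
  "hdif z = (fst z + 1, dif A (snd z))"

definition hbrk :: "int \<times> 'a \<Rightarrow> int \<times> 'a \<Rightarrow> int \<times> 'a" where
  "hbrk y z = (fst y + fst z, brk A (snd y) (snd z))"

definition hcrv :: "int \<times> 'a" where
  "hcrv = (2, crv A)"

lemma labelled_simps [simp]:
  "fst (hdif z) = fst z + 1" "fst (hbrk y z) = fst y + fst z" "fst hcrv = 2"
  "snd (hdif z) = dif A (snd z)" "snd (hbrk y z) = brk A (snd y) (snd z)" "snd hcrv = crv A"
  by (simp_all add: hdif_def hbrk_def hcrv_def)

lemma hom_labelled [simp]:
  "hom z \<Longrightarrow> hom (hdif z)" "hom y \<Longrightarrow> hom z \<Longrightarrow> hom (hbrk y z)" "hom hcrv"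
  by (simp_all add: hom_def dif_degree brk_degree crv_degree)

lemma koszul_mem: "a \<in> gr A k \<Longrightarrow> koszul l a \<in> gr A k"
  using subspace_gr subspace_neg unfolding koszul_def by auto

text \<open>Symmetry carries linearity from the first slot to all the others. Contractions and the operators
  below preserve this property, so that the inductions can be run on contracted forms.\<close>
definition symmetric_form :: "((int \<times> 'a) list \<Rightarrow> 'm) \<Rightarrow> bool" where
  "symmetric_form f \<longleftrightarrow>
     (\<forall>k a b c zs. a \<in> gr A k \<longrightarrow> b \<in> gr A k \<longrightarrow> homs zs \<longrightarrow>
        f ((k, scl A c a + b) # zs) = mscl M c (f ((k, a) # zs)) + f ((k, b) # zs)) \<and>
     (\<forall>us y z vs. homs us \<longrightarrow> hom y \<longrightarrow> hom z \<longrightarrow> homs vs \<longrightarrow>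
        f (us @ y # z # vs) = koszul (sdg y * sdg z) (f (us @ z # y # vs)))"

context
  fixes f :: "(int \<times> 'a) list \<Rightarrow> 'm"
  assumes f: "symmetric_form f"
begin

lemma form_lincomb:
  "a \<in> gr A k \<Longrightarrow> b \<in> gr A k \<Longrightarrow> homs zs \<Longrightarrow>
     f ((k, scl A c a + b) # zs) = mscl M c (f ((k, a) # zs)) + f ((k, b) # zs)"
  using f unfolding symmetric_form_def by blast

lemma form_swap_append:
  "homs us \<Longrightarrow> hom y \<Longrightarrow> hom z \<Longrightarrow> homs vs \<Longrightarrow>
     f (us @ y # z # vs) = koszul (sdg y * sdg z) (f (us @ z # y # vs))"
  using f unfolding symmetric_form_def by blast

lemma form_swap:
  "hom y \<Longrightarrow> hom z \<Longrightarrow> homs vs \<Longrightarrow> f (y # z # vs) = koszul (sdg y * sdg z) (f (z # y # vs))"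
  using form_swap_append[of "[]" y z vs] by simp

lemma form_zero:
  assumes "homs zs" shows "f ((k, 0) # zs) = 0"
proof -
  have "0 \<in> gr A k" using subspace_gr subspace_0 by blast
  from form_lincomb[OF this this assms, of 1] show ?thesis by simp
qed

lemma form_add:
  assumes "a \<in> gr A k" "b \<in> gr A k" "homs zs"
  shows "f ((k, a + b) # zs) = f ((k, a) # zs) + f ((k, b) # zs)"
  using form_lincomb[OF assms, of 1] by simp

lemma form_minus:
  assumes "a \<in> gr A k" "homs zs"
  shows "f ((k, - a) # zs) = - f ((k, a) # zs)"
proof -
  have "0 \<in> gr A k" using subspace_gr subspace_0 by blast
  from form_lincomb[OF assms(1) this assms(2), of "-1"] assms(2) show ?thesis
    by (simp add: form_zero)
qed

lemma form_koszul:
  "a \<in> gr A k \<Longrightarrow> homs zs \<Longrightarrow> f ((k, koszul l a) # zs) = koszul l (f ((k, a) # zs))"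
  by (simp add: koszul_def form_minus)

lemma symmetric_form_contract:
  assumes "hom z"
  shows "symmetric_form (\<lambda>zs. f (z # zs))"
  unfolding symmetric_form_def
proof (intro conjI allI impI)
  fix k a b c zs
  assume *: "a \<in> gr A k" "b \<in> gr A k" "homs zs"
  then have "scl A c a + b \<in> gr A k"
    using subspace_gr subspace_add subspace_scale by blast
  then have "hom (k, scl A c a + b)" "hom (k, a)" "hom (k, b)"
    using * by (auto simp: hom_def)
  then show "f (z # (k, scl A c a + b) # zs)
      = mscl M c (f (z # (k, a) # zs)) + f (z # (k, b) # zs)"
    using assms * by (simp add: form_swap[of z] form_lincomb linear_simps)
next
  fix us y w vs
  assume "homs us" "hom y" "hom w" "homs vs"
  then show "f (z # us @ y # w # vs) = koszul (sdg y * sdg w) (f (z # us @ w # y # vs))"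
    using form_swap_append[of "z # us" y w vs] assms by simp
qed

lemma form_brk_skew:
  assumes "hom y" "hom z" "homs zs"
  shows "f (hbrk y z # zs) = - koszul (fst y * fst z) (f (hbrk z y # zs))"
proof -
  have mem: "brk A (snd z) (snd y) \<in> gr A (fst y + fst z)"
    using hom_labelled(2)[of z y] assms by (simp add: hom_def add.commute)
  have "brk A (snd y) (snd z) = - koszul (fst y * fst z) (brk A (snd z) (snd y))"
    using brk_skew assms unfolding hom_def scl_ksign by blast
  then have "f (hbrk y z # zs)
      = - koszul (fst y * fst z) (f ((fst y + fst z, brk A (snd z) (snd y)) # zs))"
    using mem assms by (simp only: hbrk_def form_minus form_koszul koszul_mem)
  then show ?thesis
    by (simp only: hbrk_def add.commute[of "fst z" "fst y"])
qed

lemma form_jacobi: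
  assumes "hom x" "hom y" "hom z" "homs zs"
  shows "f (hbrk x (hbrk y z) # zs)
    = f (hbrk (hbrk x y) z # zs) + koszul (fst x * fst y) (f (hbrk y (hbrk x z) # zs))"
proof -
  have deg: "fst x + (fst y + fst z) = fst x + fst y + fst z"
    "fst y + (fst x + fst z) = fst x + fst y + fst z"
    by simp_all
  have mem: "brk A (brk A (snd x) (snd y)) (snd z) \<in> gr A (fst x + fst y + fst z)"
    "brk A (snd y) (brk A (snd x) (snd z)) \<in> gr A (fst x + fst y + fst z)"
    using hom_labelled(2)[OF hom_labelled(2)[of x y], of z]
      hom_labelled(2)[of y, OF _ hom_labelled(2)[of x z]] assms
    by (simp_all add: hom_def deg)
  have "brk A (snd x) (brk A (snd y) (snd z)) = brk A (brk A (snd x) (snd y)) (snd z)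
      + koszul (fst x * fst y) (brk A (snd y) (brk A (snd x) (snd z)))"
    using brk_jacobi assms unfolding hom_def scl_ksign by blast
  then show ?thesis
    using mem assms by (simp only: hbrk_def fst_conv snd_conv deg form_add form_koszul koszul_mem)
qed

lemma form_derivation:
  assumes "hom x" "hom y" "homs zs"
  shows "f (hdif (hbrk x y) # zs)
    = f (hbrk (hdif x) y # zs) + koszul (fst x) (f (hbrk x (hdif y) # zs))"
proof -
  have deg: "fst x + 1 + fst y = fst x + fst y + 1" "fst x + (fst y + 1) = fst x + fst y + 1"
    by simp_all
  have mem: "brk A (dif A (snd x)) (snd y) \<in> gr A (fst x + fst y + 1)"
    "brk A (snd x) (dif A (snd y)) \<in> gr A (fst x + fst y + 1)"
    using hom_labelled(2)[of "hdif x" y] hom_labelled(2)[of x "hdif y"]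
      hom_labelled(1)[of x] hom_labelled(1)[of y] assms
    by (simp_all add: hom_def deg)
  have "dif A (brk A (snd x) (snd y)) = brk A (dif A (snd x)) (snd y)
      + koszul (fst x) (brk A (snd x) (dif A (snd y)))"
    using dif_derivation assms unfolding hom_def scl_ksign by blast
  then show ?thesis
    using mem assms
    by (simp only: hbrk_def hdif_def fst_conv snd_conv deg form_add form_koszul koszul_mem)
qed

end

section \<open>The Lie derivative and the differential\<close>

text \<open>The derivation \<open>f \<mapsto> \<Sigma>\<^sub>j \<plusminus> f(\<dots>, s[a, a\<^sub>j], \<dots>)\<close>, whose sign is that of moving \<open>ad a\<close>, of degree \<open>|a|\<close>,
  past the arguments in front of the \<open>j\<close>-th one.\<close>
primrec lie_sum :: "int \<times> 'a \<Rightarrow> ((int \<times> 'a) list \<Rightarrow> 'm) \<Rightarrow> (int \<times> 'a) list \<Rightarrow> 'm" where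
  "lie_sum a f [] = 0"
| "lie_sum a f (z # zs) =
     f (hbrk a z # zs) + koszul (fst a * sdg z) (lie_sum a (\<lambda>ws. f (z # ws)) zs)"

text \<open>What \<open>D f(sa, -)\<close> contains beyond \<open>D\<close> applied to the contraction \<open>f(sa, -)\<close>; here \<open>n\<close> is the
  total degree of \<open>f\<close>. The operator has degree \<open>|a|\<close>.\<close>
definition lie_der :: "int \<Rightarrow> int \<times> 'a \<Rightarrow> ((int \<times> 'a) list \<Rightarrow> 'm) \<Rightarrow> (int \<times> 'a) list \<Rightarrow> 'm" where
  "lie_der n a f zs =
     koszul n (f (hdif a # zs)) + koszul (n * sdg a) (act M (snd a) (f zs))
     + koszul (n + sdg a) (lie_sum a f zs)"

text \<open>The total differential, obtained from the commutation rule of contractions with it. Contraction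
  by \<open>z\<close> raises the total degree by \<open>sdg z\<close>.\<close>
primrec cartan_dif :: "int \<Rightarrow> ((int \<times> 'a) list \<Rightarrow> 'm) \<Rightarrow> (int \<times> 'a) list \<Rightarrow> 'm" where
  "cartan_dif n f [] = mdif M (f []) + koszul n (f [hcrv])"
| "cartan_dif n f (z # zs) =
     cartan_dif (n + sdg z) (\<lambda>ws. f (z # ws)) zs + lie_der n z f zs"

text \<open>The Cartan relations hold on homogeneous arguments only, so rewriting with them under an
  operator needs the following congruence rules.\<close>
lemma lie_sum_cong:
  assumes "\<And>ws. homs ws \<Longrightarrow> f ws = g ws" "hom a" "homs zs"
  shows "lie_sum a f zs = lie_sum a g zs"
  using assms(1,3)
proof (induction zs arbitrary: f g)
  case (Cons z zs)
  have "lie_sum a (\<lambda>ws. f (z # ws)) zs = lie_sum a (\<lambda>ws. g (z # ws)) zs"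
    using Cons.prems by (intro Cons.IH) auto
  with Cons.prems assms(2) show ?case by simp
qed simp

lemma lie_der_cong:
  assumes "\<And>ws. homs ws \<Longrightarrow> f ws = g ws" "hom a" "homs zs"
  shows "lie_der n a f zs = lie_der n a g zs"
  using assms lie_sum_cong[OF assms] by (simp add: lie_der_def)

lemma cartan_dif_cong:
  assumes "\<And>ws. homs ws \<Longrightarrow> f ws = g ws" "homs zs"
  shows "cartan_dif n f zs = cartan_dif n g zs"
  using assms
proof (induction zs arbitrary: n f g)
  case (Cons z zs)
  have "cartan_dif (n + sdg z) (\<lambda>ws. f (z # ws)) zs = cartan_dif (n + sdg z) (\<lambda>ws. g (z # ws)) zs"
    using Cons.prems by (intro Cons.IH) auto
  moreover have "lie_der n z f zs = lie_der n z g zs"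
    using Cons.prems by (intro lie_der_cong) auto
  ultimately show ?case by simp
qed simp

lemma lie_sum_add: "lie_sum a (\<lambda>ws. f ws + g ws) zs = lie_sum a f zs + lie_sum a g zs"
  by (induction zs arbitrary: f g) (simp_all add: algebra_simps)

lemma lie_sum_scale: "lie_sum a (\<lambda>ws. mscl M c (f ws)) zs = mscl M c (lie_sum a f zs)"
  by (induction zs arbitrary: f) (simp_all add: M.scale_right_distrib linear_simps)

lemma lie_der_add: "lie_der n a (\<lambda>ws. f ws + g ws) zs = lie_der n a f zs + lie_der n a g zs"
  by (simp add: lie_der_def lie_sum_add linear_simps)

lemma lie_der_scale: "lie_der n a (\<lambda>ws. mscl M c (f ws)) zs = mscl M c (lie_der n a f zs)"
  by (simp add: lie_der_def lie_sum_scale linear_simps M.scale_right_distrib)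

lemma lie_der_koszul: "lie_der n a (\<lambda>ws. koszul k (f ws)) zs = koszul k (lie_der n a f zs)"
  using lie_der_scale[of n a "ksign k" f zs] by (simp only: mscl_ksign)

lemma cartan_dif_add: "cartan_dif n (\<lambda>ws. f ws + g ws) zs = cartan_dif n f zs + cartan_dif n g zs"
  by (induction zs arbitrary: n f g) (simp_all add: lie_der_add linear_simps algebra_simps)

lemma cartan_dif_scale: "cartan_dif n (\<lambda>ws. mscl M c (f ws)) zs = mscl M c (cartan_dif n f zs)"
  by (induction zs arbitrary: n f)
    (simp_all add: lie_der_scale linear_simps M.scale_right_distrib)

lemma cartan_dif_koszul: "cartan_dif n (\<lambda>ws. koszul k (f ws)) zs = koszul k (cartan_dif n f zs)"
  using cartan_dif_scale[of n "ksign k" f zs] by (simp only: mscl_ksign)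

section \<open>Cartan relations\<close>

text \<open>The bracket term is the head of the Lie sum. In the term with \<open>hdif a\<close>, moving \<open>s(da)\<close> past \<open>z\<close> accounts
  both for the sign in front and for the total degree of the contracted form.\<close>
lemma lie_der_Cons:
  assumes f: "symmetric_form f" and hom: "hom a" "hom z" "homs zs"
  shows "lie_der n a f (z # zs) =
    koszul (sdg a * sdg z) (lie_der (n + sdg z) a (\<lambda>ws. f (z # ws)) zs)
    + koszul (n + sdg a) (f (hbrk a z # zs))"
  using hom form_swap[OF f, of "hdif a" z zs]
  by (simp add: lie_der_def)
    (cases "even n"; cases "even (fst a)"; cases "even (fst z)"; simp add: koszul_def)

lemma hom_lincomb: "a \<in> gr A k \<Longrightarrow> b \<in> gr A k \<Longrightarrow> hom (k, scl A c a + b)"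
  using subspace_gr subspace_add subspace_scale unfolding hom_def by auto

lemma lie_der_lincomb:
  "lie_der n a (\<lambda>ws. mscl M c (f ws) + g ws) zs = mscl M c (lie_der n a f zs) + lie_der n a g zs"
  by (simp add: lie_der_add lie_der_scale)

lemma cartan_dif_lincomb:
  "cartan_dif n (\<lambda>ws. mscl M c (f ws) + g ws) zs = mscl M c (cartan_dif n f zs) + cartan_dif n g zs"
  by (simp add: cartan_dif_add cartan_dif_scale)

lemma lie_der_contract_lincomb:
  assumes f: "symmetric_form f" and uv: "u \<in> gr A k" "v \<in> gr A k" and hom: "hom a" "homs zs"
  shows "lie_der n a (\<lambda>ws. f ((k, scl A c u + v) # ws)) zs =
    mscl M c (lie_der n a (\<lambda>ws. f ((k, u) # ws)) zs) + lie_der n a (\<lambda>ws. f ((k, v) # ws)) zs"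
  unfolding lie_der_lincomb[symmetric]
  by (rule lie_der_cong) (use form_lincomb[OF f uv] hom in auto)

text \<open>Contracting twice produces, besides the Lie derivative of the double contraction, the two terms
  \<open>f(y, s[a, z], \<dots>)\<close> and \<open>f(z, s[a, y], \<dots>)\<close>, which are exchanged by the swap.\<close>
lemma lie_der_swap:
  assumes "symmetric_form f" "hom a" "homs us" "hom y" "hom z" "homs vs"
  shows "lie_der n a f (us @ y # z # vs) = koszul (sdg y * sdg z) (lie_der n a f (us @ z # y # vs))"
  using assms(1,3)
proof (induction us arbitrary: n f)
  case Nil
  note f = Nil.prems(1)
  let ?g = "\<lambda>w x ws. f (w # x # ws)"
  have expand: "lie_der n a f (u # w # vs) =
      koszul (sdg a * sdg u + sdg a * sdg w) (lie_der (n + sdg u + sdg w) a (?g u w) vs)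
      + koszul (sdg a * sdg u + (n + sdg u + sdg a)) (f (u # hbrk a w # vs))
      + koszul (n + sdg a + (fst a + sdg u) * sdg w) (f (w # hbrk a u # vs))"
    if "hom u" "hom w" for u w
  proof -
    have "lie_der (n + sdg u) a (\<lambda>ws. f (u # ws)) (w # vs)
        = koszul (sdg a * sdg w) (lie_der (n + sdg u + sdg w) a (?g u w) vs)
          + koszul (n + sdg u + sdg a) (f (u # hbrk a w # vs))"
      using lie_der_Cons[OF symmetric_form_contract[OF f that(1)] assms(2) that(2) assms(6)] .
    moreover have "f (hbrk a u # w # vs) = koszul ((fst a + sdg u) * sdg w) (f (w # hbrk a u # vs))"
      using form_swap[OF f, of "hbrk a u" w vs] that assms by (simp add: add_diff_eq)
    ultimately show ?thesis
      using lie_der_Cons[OF f, of a u "w # vs" n] that assms by simp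
  qed
  have contract: "lie_der (n + sdg y + sdg z) a (?g y z) vs
      = koszul (sdg y * sdg z) (lie_der (n + sdg z + sdg y) a (?g z y) vs)"
    unfolding lie_der_koszul[symmetric]
    using lie_der_cong[of "?g y z" "\<lambda>ws. koszul (sdg y * sdg z) (?g z y ws)" a vs]
      form_swap[OF f, of y z] assms by (simp add: add_ac)
  show ?case
    unfolding append_Nil expand[OF assms(4,5)] expand[OF assms(5,4)] contract
    by (cases "even n"; cases "even (fst a)"; cases "even (fst z)"; cases "even (fst y)";
        simp add: koszul_def)
next
  case (Cons u us)
  have "lie_der (n + sdg u) a (\<lambda>ws. f (u # ws)) (us @ y # z # vs)
      = koszul (sdg y * sdg z) (lie_der (n + sdg u) a (\<lambda>ws. f (u # ws)) (us @ z # y # vs))"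
    using Cons.IH[OF symmetric_form_contract[OF Cons.prems(1), of u]] Cons.prems by simp
  moreover have "f (hbrk a u # us @ y # z # vs) = koszul (sdg y * sdg z) (f (hbrk a u # us @ z # y # vs))"
    using form_swap_append[OF Cons.prems(1), of "hbrk a u # us" y z vs] Cons.prems assms by simp
  ultimately show ?case
    using Cons.prems assms by (simp add: lie_der_Cons add.commute)
qed

lemma symmetric_form_lie_der:
  assumes f: "symmetric_form f" and a: "hom a"
  shows "symmetric_form (lie_der n a f)"
  unfolding symmetric_form_def
proof (intro conjI allI impI)
  fix k u v c zs
  assume uv: "u \<in> gr A k" "v \<in> gr A k" and zs: "homs zs"
  have "snd a \<in> gr A (fst a)" using a by (simp add: hom_def)
  then have br: "brk A (snd a) u \<in> gr A (fst a + k)" "brk A (snd a) v \<in> gr A (fst a + k)"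
    using uv brk_degree by blast+
  have "f (hbrk a (k, scl A c u + v) # zs) = mscl M c (f (hbrk a (k, u) # zs)) + f (hbrk a (k, v) # zs)"
    using form_lincomb[OF f br zs] by (simp add: hbrk_def linear_simps)
  moreover have "hom (k, u)" "hom (k, v)"
    using uv by (simp_all add: hom_def)
  ultimately show "lie_der n a f ((k, scl A c u + v) # zs) =
      mscl M c (lie_der n a f ((k, u) # zs)) + lie_der n a f ((k, v) # zs)"
    using f uv a zs
    by (simp add: lie_der_Cons hom_lincomb lie_der_contract_lincomb linear_simps
        M.scale_right_distrib)
next
  fix us y z vs
  assume "homs us" "hom y" "hom z" "homs vs"
  then show "lie_der n a f (us @ y # z # vs) = koszul (sdg y * sdg z) (lie_der n a f (us @ z # y # vs))"
    by (rule lie_der_swap[OF assms])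
qed

lemma lie_der_arg_lincomb:
  assumes f: "symmetric_form f" and uv: "u \<in> gr A k" "v \<in> gr A k" and zs: "homs zs"
  shows "lie_der n (k, scl A c u + v) f zs
    = mscl M c (lie_der n (k, u) f zs) + lie_der n (k, v) f zs"
proof -
  have "lie_sum (k, scl A c u + v) f zs
      = mscl M c (lie_sum (k, u) f zs) + lie_sum (k, v) f zs"
    using f zs
  proof (induction zs arbitrary: f)
    case (Cons z zs)
    have "snd z \<in> gr A (fst z)" using Cons.prems by (simp add: hom_def)
    then have br: "brk A u (snd z) \<in> gr A (k + fst z)" "brk A v (snd z) \<in> gr A (k + fst z)"
      using uv brk_degree by blast+
    have "f (hbrk (k, scl A c u + v) z # zs)
        = mscl M c (f (hbrk (k, u) z # zs)) + f (hbrk (k, v) z # zs)"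
      using form_lincomb[OF Cons.prems(1) br, of zs c] Cons.prems
      by (simp add: hbrk_def linear_simps)
    moreover have "symmetric_form (\<lambda>ws. f (z # ws))"
      using Cons.prems by (simp add: symmetric_form_contract)
    ultimately show ?case
      using Cons by (simp add: linear_simps M.scale_right_distrib)
  qed simp
  moreover have "f (hdif (k, scl A c u + v) # zs)
      = mscl M c (f (hdif (k, u) # zs)) + f (hdif (k, v) # zs)"
    using form_lincomb[OF f, of "dif A u" "k + 1" "dif A v"] uv zs dif_degree
    by (simp add: hdif_def linear_simps)
  ultimately show ?thesis
    by (simp add: lie_der_def linear_simps M.scale_right_distrib)
qed

text \<open>After contraction with \<open>c\<close>, the mixed terms containing \<open>[a, c]\<close> or \<open>[b, c]\<close> cancel in pairs, the
  double brackets combine by the Jacobi identity, and the rest is the claim for \<open>f(c, -)\<close>.\<close>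
lemma lie_commutator:
  assumes "symmetric_form f" "hom a" "hom b" "homs zs"
  shows "lie_der (n + fst a) b (lie_der n a f) zs
    + koszul (sdg a * sdg b) (lie_der (n + fst b) a (lie_der n b f) zs)
    = koszul (n + sdg a) (lie_der n (hbrk a b) f zs)"
  using assms(1,4)
proof (induction zs arbitrary: n f)
  case Nil
  note f = Nil.prems(1)
  have expand: "lie_der (n + fst x) y (lie_der n x f) [] =
     koszul (n + fst x + n) (f [hdif x, hdif y])
      + koszul (n + fst x + n * sdg x) (act M (snd x) (f [hdif y]))
      + koszul (n + fst x + n + sdg x) (f [hbrk x (hdif y)])
      + koszul ((n + fst x) * sdg y + n) (act M (snd y) (f [hdif x]))
      + koszul ((n + fst x) * sdg y + n * sdg x) (act M (snd y) (act M (snd x) (f [])))" for x y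
    by (simp add: lie_der_def linear_simps algebra_simps)
  have "f [hdif (hbrk a b)] = f [hbrk (hdif a) b] + koszul (fst a) (f [hbrk a (hdif b)])"
    using form_derivation[OF f] assms by simp
  moreover have "f [hbrk (hdif a) b] = - koszul ((fst a + 1) * fst b) (f [hbrk b (hdif a)])"
    using form_brk_skew[OF f, of "hdif a" b] assms by simp
  moreover have "f [hdif b, hdif a] = koszul (fst a * fst b) (f [hdif a, hdif b])"
    using form_swap[OF f, of "hdif b" "hdif a" "[]"] assms by (simp add: mult.commute)
  moreover have "act M (snd (hbrk a b)) (f []) = act M (snd a) (act M (snd b) (f []))
      - koszul (fst a * fst b) (act M (snd b) (act M (snd a) (f [])))"
    using act_brk assms unfolding hom_def hbrk_def mscl_ksign by simp
  ultimately show ?case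
    unfolding expand
    by (simp add: lie_der_def[of n "hbrk a b"] linear_simps del: labelled_simps(4-6))
      (cases "even n"; cases "even (fst a)"; cases "even (fst b)"; simp add: koszul_def)
next
  case (Cons c zs)
  note f = Cons.prems(1)
  let ?fc = "\<lambda>ws. f (c # ws)"
  have expand: "lie_der (n + fst x) y (lie_der n x f) (c # zs) =
      koszul (sdg y * sdg c + sdg x * sdg c) (lie_der (n + sdg c + fst x) y (lie_der (n + sdg c) x ?fc) zs)
      + koszul (sdg y * sdg c + n + sdg x) (lie_der (n + fst x + sdg c) y (\<lambda>ws. f (hbrk x c # ws)) zs)
      + koszul (n + fst x + sdg y + sdg x * (fst y + sdg c))
          (lie_der (n + fst y + sdg c) x (\<lambda>ws. f (hbrk y c # ws)) zs)
      + koszul (n + fst x + sdg y + n + sdg x) (f (hbrk x (hbrk y c) # zs))"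
    if "hom x" "hom y" for x y
  proof -
    have "lie_der (n + fst x + sdg c) y (\<lambda>ws. lie_der n x f (c # ws)) zs
       = lie_der (n + fst x + sdg c) y (\<lambda>ws. koszul (sdg x * sdg c) (lie_der (n + sdg c) x ?fc ws)
           + koszul (n + sdg x) (f (hbrk x c # ws))) zs"
      by (rule lie_der_cong) (use f that Cons.prems in \<open>auto simp: lie_der_Cons\<close>)
    then show ?thesis
      using that f Cons.prems
      by (simp add: lie_der_Cons symmetric_form_lie_der lie_der_add lie_der_koszul)
        (simp add: algebra_simps)
  qed
  have "lie_der (n + sdg c + fst a) b (lie_der (n + sdg c) a ?fc) zs
    + koszul (sdg a * sdg b) (lie_der (n + sdg c + fst b) a (lie_der (n + sdg c) b ?fc) zs)
    = koszul (n + sdg c + sdg a) (lie_der (n + sdg c) (hbrk a b) ?fc zs)"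
    using Cons.IH[OF symmetric_form_contract[OF f, of c]] Cons.prems by simp
  then have IH: "lie_der (n + sdg c + fst a) b (lie_der (n + sdg c) a ?fc) zs =
    koszul (n + sdg c + sdg a) (lie_der (n + sdg c) (hbrk a b) ?fc zs)
    - koszul (sdg a * sdg b) (lie_der (n + sdg c + fst b) a (lie_der (n + sdg c) b ?fc) zs)"
    by (simp add: eq_diff_eq)
  have jac: "f (hbrk a (hbrk b c) # zs)
    = f (hbrk (hbrk a b) c # zs) + koszul (fst a * fst b) (f (hbrk b (hbrk a c) # zs))"
    using form_jacobi[OF f, of a b c zs] assms Cons.prems by simp
  have right: "lie_der n (hbrk a b) f (c # zs) =
     koszul ((fst a + sdg b) * sdg c) (lie_der (n + sdg c) (hbrk a b) ?fc zs)
    + koszul (n + fst a + sdg b) (f (hbrk (hbrk a b) c # zs))"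
    using lie_der_Cons[OF f, of "hbrk a b" c zs n] assms Cons.prems by (simp add: algebra_simps)
  show ?case
    unfolding expand[OF assms(2,3)] expand[OF assms(3,2)] IH right jac
    by (cases "even n"; cases "even (fst a)"; cases "even (fst b)"; cases "even (fst c)";
        simp add: koszul_def)
qed

text \<open>Contracting twice produces \<open>L\<^sub>y \<iota>\<^sub>z\<close> and \<open>L\<^sub>z \<iota>\<^sub>y\<close>, which are exchanged by the swap, and \<open>\<iota>\<^bsub>s[y,z]\<^esub>\<close>, which has
  the right symmetry because the bracket is skew.\<close>
lemma cartan_dif_swap:
  assumes "symmetric_form f" "homs us" "hom y" "hom z" "homs vs"
  shows "cartan_dif n f (us @ y # z # vs) = koszul (sdg y * sdg z) (cartan_dif n f (us @ z # y # vs))"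
  using assms(1,2)
proof (induction us arbitrary: n f)
  case Nil
  note f = Nil.prems(1)
  let ?g = "\<lambda>w x ws. f (w # x # ws)"
  have contract: "cartan_dif (n + sdg y + sdg z) (?g y z) vs
      = koszul (sdg y * sdg z) (cartan_dif (n + sdg z + sdg y) (?g z y) vs)"
    unfolding cartan_dif_koszul[symmetric]
    using cartan_dif_cong[of "?g y z" "\<lambda>ws. koszul (sdg y * sdg z) (?g z y ws)" vs]
      form_swap[OF f, of y z] assms by (simp add: add_ac)
  have skew: "f (hbrk y z # vs) = - koszul (fst y * fst z) (f (hbrk z y # vs))"
    using form_brk_skew[OF f, of y z vs] assms by simp
  show ?case
    using contract
    unfolding append_Nil cartan_dif.simps lie_der_Cons[OF f assms(3,4,5)]
      lie_der_Cons[OF f assms(4,3,5)] skew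
    by (cases "even n"; cases "even (fst z)"; cases "even (fst y)";
        simp add: koszul_def)
next
  case (Cons u us)
  have "cartan_dif (n + sdg u) (\<lambda>ws. f (u # ws)) (us @ y # z # vs)
      = koszul (sdg y * sdg z) (cartan_dif (n + sdg u) (\<lambda>ws. f (u # ws)) (us @ z # y # vs))"
    using Cons.IH[OF symmetric_form_contract[OF Cons.prems(1), of u]] Cons.prems by simp
  moreover have "lie_der n u f (us @ y # z # vs) = koszul (sdg y * sdg z) (lie_der n u f (us @ z # y # vs))"
    using lie_der_swap[OF Cons.prems(1), of u us y z vs] Cons.prems assms by simp
  ultimately show ?case
    by simp
qed

lemma symmetric_form_cartan_dif:
  assumes f: "symmetric_form f"
  shows "symmetric_form (cartan_dif n f)"
  unfolding symmetric_form_def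
proof (intro conjI allI impI)
  fix k u v c zs
  assume uv: "u \<in> gr A k" "v \<in> gr A k" and zs: "homs zs"
  have "cartan_dif (n + (k - 1)) (\<lambda>ws. f ((k, scl A c u + v) # ws)) zs
    = cartan_dif (n + (k - 1)) (\<lambda>ws. mscl M c (f ((k, u) # ws)) + f ((k, v) # ws)) zs"
    by (rule cartan_dif_cong) (use form_lincomb[OF f uv] zs in auto)
  then show "cartan_dif n f ((k, scl A c u + v) # zs) =
      mscl M c (cartan_dif n f ((k, u) # zs)) + cartan_dif n f ((k, v) # zs)"
    using lie_der_arg_lincomb[OF f uv zs]
    by (simp add: cartan_dif_lincomb M.scale_right_distrib)
next
  fix us y z vs
  assume "homs us" "hom y" "hom z" "homs vs"
  then show "cartan_dif n f (us @ y # z # vs) = koszul (sdg y * sdg z) (cartan_dif n f (us @ z # y # vs))"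
    by (rule cartan_dif_swap[OF assms])
qed

text \<open>After contraction with \<open>y\<close>, the contraction by \<open>[a, y]\<close> occurs once before and once after \<open>D\<close>. The
  difference is the Lie derivative along \<open>[a, y]\<close>, which is compensated by the commutator of the Lie
  derivatives along \<open>a\<close> and \<open>y\<close>.\<close>
lemma cartan_dif_lie_der:
  assumes "symmetric_form f" "hom a" "homs zs"
  shows "cartan_dif (n + fst a) (lie_der n a f) zs + lie_der (n + 1) a (cartan_dif n f) zs = 0"
  using assms(1,3)
proof (induction zs arbitrary: n f)
  case Nil
  note f = Nil.prems(1)
  have act_a: "mdif M (act M (snd a) (f [])) =
      act M (dif A (snd a)) (f []) + koszul (fst a) (act M (snd a) (mdif M (f [])))"
    using mdif_act assms unfolding hom_def mscl_ksign by blast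
  have square: "hdif (hdif a) = hbrk hcrv a"
    by (simp add: hdif_def hbrk_def hcrv_def dif_dif)
  have skew: "f [hbrk hcrv a] = - f [hbrk a hcrv]"
    using form_brk_skew[OF f, of hcrv a "[]"] assms by (simp add: koszul_def)
  have swap: "f [hcrv, hdif a] = koszul (fst a) (f [hdif a, hcrv])"
    using form_swap[OF f, of hcrv "hdif a" "[]"] assms by simp
  show ?case
    by (simp add: lie_der_def linear_simps square skew act_a swap)
      (cases "even n"; cases "even (fst a)"; simp add: koszul_def)
next
  case (Cons y zs)
  note f = Cons.prems(1)
  have y: "hom y" and zs: "homs zs" using Cons.prems by simp_all
  let ?fy = "\<lambda>ws. f (y # ws)" and ?fb = "\<lambda>ws. f (hbrk a y # ws)"
  have "cartan_dif (n + fst a + sdg y) (\<lambda>ws. lie_der n a f (y # ws)) zs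
      = cartan_dif (n + fst a + sdg y) (\<lambda>ws. koszul (sdg a * sdg y) (lie_der (n + sdg y) a ?fy ws)
           + koszul (n + sdg a) (?fb ws)) zs"
    by (rule cartan_dif_cong) (use f assms y zs in \<open>auto simp: lie_der_Cons\<close>)
  then have left: "cartan_dif (n + fst a) (lie_der n a f) (y # zs) =
      koszul (sdg a * sdg y) (cartan_dif (n + sdg y + fst a) (lie_der (n + sdg y) a ?fy) zs)
      + koszul (n + sdg a) (cartan_dif (n + sdg (hbrk a y)) ?fb zs)
      + lie_der (n + fst a) y (lie_der n a f) zs"
    by (simp add: cartan_dif_add cartan_dif_koszul algebra_simps)
  have "lie_der (n + 1) a (cartan_dif n f) (y # zs) =
      koszul (sdg a * sdg y) (lie_der (n + 1 + sdg y) a (\<lambda>ws. cartan_dif n f (y # ws)) zs)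
      + koszul (n + 1 + sdg a) (cartan_dif n f (hbrk a y # zs))"
    by (rule lie_der_Cons[OF symmetric_form_cartan_dif[OF f] assms(2) y zs])
  then have right: "lie_der (n + 1) a (cartan_dif n f) (y # zs) =
      koszul (sdg a * sdg y) (lie_der (n + sdg y + 1) a (cartan_dif (n + sdg y) ?fy) zs)
      + koszul (sdg a * sdg y) (lie_der (n + fst y) a (lie_der n y f) zs)
      + koszul (n + 1 + sdg a) (cartan_dif (n + sdg (hbrk a y)) ?fb zs)
      + koszul (n + 1 + sdg a) (lie_der n (hbrk a y) f zs)"
    by (simp add: lie_der_add algebra_simps)
  have IH: "cartan_dif (n + sdg y + fst a) (lie_der (n + sdg y) a ?fy) zs
      = - lie_der (n + sdg y + 1) a (cartan_dif (n + sdg y) ?fy) zs"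
    using Cons.IH[OF symmetric_form_contract[OF f y] zs, of "n + sdg y"]
    by (simp only: eq_neg_iff_add_eq_0)
  have comm: "lie_der (n + fst a) y (lie_der n a f) zs
    = koszul (n + sdg a) (lie_der n (hbrk a y) f zs)
      - koszul (sdg a * sdg y) (lie_der (n + fst y) a (lie_der n y f) zs)"
    using lie_commutator[OF f assms(2) y zs, of n] by (simp only: eq_diff_eq)
  show ?case
    unfolding left right IH comm
    by (simp add: koszul_def)
qed

lemma cartan_dif_square:
  assumes "symmetric_form f" "homs zs"
  shows "cartan_dif (n + 1) (cartan_dif n f) zs = 0"
  using assms
proof (induction zs arbitrary: n f)
  case Nil
  note f = Nil.prems(1)
  \<comment> \<open>\<open>sh\<close> has degree \<open>1\<close>, so a symmetric form is alternating on it.\<close>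
  have "f [hcrv, hcrv] = - f [hcrv, hcrv]"
    using form_swap[OF f, of hcrv hcrv "[]"] by (simp add: koszul_def)
  then have "mscl M 2 (f [hcrv, hcrv]) = 0"
    using M.scale_left_distrib[of 1 1 "f [hcrv, hcrv]"] by (simp add: eq_neg_iff_add_eq_0)
  then have "f [hcrv, hcrv] = 0"
    by (simp only: M.scale_eq_0_iff) simp
  moreover have "f [hdif hcrv] = 0"
    using form_zero[OF f] by (simp add: hdif_def hcrv_def dif_crv)
  ultimately show ?case
    by (simp add: lie_der_def linear_simps mdif_mdif) (simp add: koszul_def)
next
  case (Cons z zs)
  have z: "hom z" and zs: "homs zs" using Cons.prems by simp_all
  have "cartan_dif (n + sdg z + 1) (\<lambda>ws. cartan_dif n f (z # ws)) zs
      = cartan_dif (n + sdg z + 1) (cartan_dif (n + sdg z) (\<lambda>ws. f (z # ws))) zs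
        + cartan_dif (n + fst z) (lie_der n z f) zs"
    by (simp add: cartan_dif_add)
  then have "cartan_dif (n + 1) (cartan_dif n f) (z # zs)
      = cartan_dif (n + fst z) (lie_der n z f) zs + lie_der (n + 1) z (cartan_dif n f) zs"
    using Cons.IH[OF symmetric_form_contract[OF Cons.prems(1) z] zs, of "n + sdg z"]
    by (simp add: add_ac)
  then show ?case
    using cartan_dif_lie_der[OF Cons.prems(1) z zs, of n] by simp
qed

section \<open>Degrees\<close>

definition form_degree :: "int \<Rightarrow> ((int \<times> 'a) list \<Rightarrow> 'm) \<Rightarrow> bool" where
  "form_degree n f \<longleftrightarrow> (\<forall>zs. homs zs \<longrightarrow> f zs \<in> mgr M (n + sum_list (map sdg zs)))"

lemma mgr_closed:
  "u \<in> mgr M k \<Longrightarrow> v \<in> mgr M k \<Longrightarrow> u + v \<in> mgr M k" "u \<in> mgr M k \<Longrightarrow> koszul l u \<in> mgr M k"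
  "0 \<in> mgr M k"
  using M.subspace_gr M.subspace_add M.subspace_neg M.subspace_0 unfolding koszul_def by auto

lemma form_degree_contract:
  "form_degree n f \<Longrightarrow> hom z \<Longrightarrow> form_degree (n + sdg z) (\<lambda>zs. f (z # zs))"
  unfolding form_degree_def by (auto dest: spec[of _ "z # _"] simp: add_ac)

lemma lie_sum_degree:
  assumes "form_degree n f" "hom a" "homs zs"
  shows "lie_sum a f zs \<in> mgr M (n + fst a + sum_list (map sdg zs))"
  using assms(1,3)
proof (induction zs arbitrary: n f)
  case (Cons z zs)
  then have "lie_sum a (\<lambda>ws. f (z # ws)) zs \<in> mgr M (n + sdg z + fst a + sum_list (map sdg zs))"
    by (intro Cons.IH form_degree_contract) auto
  moreover have "f (hbrk a z # zs) \<in> mgr M (n + sum_list (map sdg (hbrk a z # zs)))"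
    using Cons.prems assms(2)
    by (intro Cons.prems(1)[unfolded form_degree_def, rule_format]) simp
  ultimately show ?case
    by (auto intro!: mgr_closed simp: algebra_simps)
qed (simp add: mgr_closed)

lemma lie_der_degree:
  assumes "form_degree n f" "hom a" "homs zs"
  shows "lie_der m a f zs \<in> mgr M (n + fst a + sum_list (map sdg zs))"
proof -
  have "f (hdif a # zs) \<in> mgr M (n + sum_list (map sdg (hdif a # zs)))"
    using assms by (intro assms(1)[unfolded form_degree_def, rule_format]) simp
  moreover have "act M (snd a) (f zs) \<in> mgr M (fst a + (n + sum_list (map sdg zs)))"
    using assms act_degree unfolding form_degree_def hom_def by blast
  ultimately show ?thesis
    unfolding lie_der_def using lie_sum_degree[OF assms]
    by (auto intro!: mgr_closed simp: algebra_simps)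
qed

lemma form_degree_cartan_dif:
  assumes "form_degree n f"
  shows "form_degree (n + 1) (cartan_dif m f)"
proof -
  have "cartan_dif m f zs \<in> mgr M (n + 1 + sum_list (map sdg zs))" if "homs zs" for zs
    using that assms
  proof (induction zs arbitrary: n m f)
    case Nil
    have "f [] \<in> mgr M n" "f [hcrv] \<in> mgr M (n + 1)"
      using Nil.prems(2)[unfolded form_degree_def, rule_format, of "[]"]
        Nil.prems(2)[unfolded form_degree_def, rule_format, of "[hcrv]"] by auto
    then show ?case
      by (auto intro!: mgr_closed mdif_degree)
  next
    case (Cons z zs)
    have "cartan_dif (m + sdg z) (\<lambda>ws. f (z # ws)) zs \<in> mgr M (n + sdg z + 1 + sum_list (map sdg zs))"
      using Cons.prems by (intro Cons.IH form_degree_contract) auto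
    moreover have "lie_der m z f zs \<in> mgr M (n + fst z + sum_list (map sdg zs))"
      using Cons.prems by (intro lie_der_degree) auto
    ultimately show ?case
      by (auto intro!: mgr_closed simp: algebra_simps)
  qed
  then show ?thesis
    by (simp add: form_degree_def)
qed

end

section \<open>The differential as an explicit sum\<close>

lemma sum_lessThan_Suc_minus_0: "(\<Sum>l\<in>{..<Suc j} - {0}. g l) = (\<Sum>l<j. g (Suc l))"
proof -
  have "{..<Suc j} - {0} = Suc ` {..<j}" by (auto simp: lessThan_Suc_eq_insert_0)
  then show ?thesis by (simp add: sum.reindex)
qed

lemma sum_lessThan_Suc_minus_Suc:
  "(\<Sum>l\<in>{..<Suc j} - {Suc i}. g l) = g 0 + (\<Sum>l\<in>{..<j} - {i}. g (Suc l))"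
proof -
  have "{..<Suc j} - {Suc i} = insert 0 (Suc ` ({..<j} - {i}))"
    by (auto simp: lessThan_Suc_eq_insert_0)
  moreover have "(\<Sum>l\<in>Suc ` ({..<j} - {i}). g l) = (\<Sum>l\<in>{..<j} - {i}. g (Suc l))"
    by (simp add: sum.reindex)
  ultimately show ?thesis by simp
qed

lemma omit_Cons [simp]: "omit 0 (z # zs) = zs" "omit (Suc i) (z # zs) = z # omit i zs"
  by (simp_all add: omit_def)

lemma length_omit: "i < length zs \<Longrightarrow> length (omit i zs) = length zs - 1"
  by (simp add: omit_def)

lemma map_omit: "map g (omit i zs) = omit i (map g zs)"
  by (simp add: omit_def take_map drop_map)

lemma list_all_omit: "list_all P zs \<Longrightarrow> list_all P (omit i zs)"
  by (auto simp: omit_def list_all_iff dest: in_set_takeD in_set_dropD)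

context cdg_module
begin

text \<open>The three sums below are those of \<open>d_int\<close> and \<open>d_Ch\<close> on labelled arguments. Each satisfies a
  recursion in the first argument; combined with \<open>d\<^sub>M\<close> and the curvature term, these recursions give
  that of \<open>cartan_dif\<close>.\<close>
definition internal_sum :: "((int \<times> 'a) list \<Rightarrow> 'm) \<Rightarrow> (int \<times> 'a) list \<Rightarrow> 'm" where
  "internal_sum f zs =
     (\<Sum>i<length zs. koszul (\<Sum>l<i. sdg (zs ! l)) (f (zs[i := hdif (zs ! i)])))"

definition action_sum :: "int \<Rightarrow> ((int \<times> 'a) list \<Rightarrow> 'm) \<Rightarrow> (int \<times> 'a) list \<Rightarrow> 'm" where
  "action_sum n f zs =
     (\<Sum>i<length zs. koszul (n * sdg (zs ! i) + sdg (zs ! i) * (\<Sum>l<i. sdg (zs ! l)))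
        (act M (snd (zs ! i)) (f (omit i zs))))"

definition bracket_sum :: "((int \<times> 'a) list \<Rightarrow> 'm) \<Rightarrow> (int \<times> 'a) list \<Rightarrow> 'm" where
  "bracket_sum f zs =
     (\<Sum>j<length zs. \<Sum>i<j.
        koszul (sdg (zs ! i) * (\<Sum>l<i. sdg (zs ! l))
            + sdg (zs ! j) * (\<Sum>l\<in>{..<j} - {i}. sdg (zs ! l)) + fst (zs ! i))
          (f (hbrk (zs ! i) (zs ! j) # omit i (omit j zs))))"

lemma homs_nth: "homs zs \<Longrightarrow> i < length zs \<Longrightarrow> hom (zs ! i)"
  by (simp add: list_all_length)

lemma internal_sum_Cons:
  "internal_sum f (z # zs) = f (hdif z # zs) + koszul (sdg z) (internal_sum (\<lambda>ws. f (z # ws)) zs)"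
  unfolding internal_sum_def length_Cons sum.lessThan_Suc_shift by (simp add: koszul_sum)

lemma action_sum_Cons:
  "action_sum n f (z # zs) =
     koszul (n * sdg z) (act M (snd z) (f zs)) + action_sum (n + sdg z) (\<lambda>ws. f (z # ws)) zs"
proof -
  have exponent: "n * s + s * (t + r) = (n + t) * s + s * r" for s t r :: int
    by (simp add: algebra_simps)
  show ?thesis
    unfolding action_sum_def length_Cons sum.lessThan_Suc_shift
    by (simp add: exponent)
qed

text \<open>The Chevalley differential puts the bracket \<open>s[a, a\<^sub>j]\<close> in front instead of at the place of \<open>a\<^sub>j\<close>. Passing
  the arguments before \<open>a\<^sub>j\<close> costs \<open>|a| + |sa\<^sub>j|\<close> times their degree, and the part with \<open>|sa\<^sub>j|\<close> is already
  present as the sign of moving \<open>a\<^sub>j\<close> out.\<close>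
lemma lie_sum_moved_to_front:
  assumes "symmetric_form f" "hom a" "homs zs"
  shows "(\<Sum>j<length zs. koszul (sdg (zs ! j) * (\<Sum>l<j. sdg (zs ! l)))
      (f (hbrk a (zs ! j) # omit j zs))) = lie_sum a f zs"
  using assms(1,3)
proof (induction zs arbitrary: f)
  case (Cons z zs)
  have "koszul (sdg (zs ! j) * (sdg z + r)) (f (hbrk a (zs ! j) # z # omit j zs))
      = koszul (fst a * sdg z) (koszul (sdg (zs ! j) * r) (f (z # hbrk a (zs ! j) # omit j zs)))"
    if "j < length zs" for j r
  proof -
    have "hom (zs ! j)" "homs (omit j zs)"
      using Cons.prems that by (auto intro: homs_nth list_all_omit)
    then show ?thesis
      using form_swap[OF Cons.prems(1), of "hbrk a (zs ! j)" z "omit j zs"] assms(2) Cons.prems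
      by (auto simp: koszul_def)
  qed
  then have "(\<Sum>j<length zs. koszul (sdg (zs ! j) * (sdg z + (\<Sum>l<j. sdg (zs ! l))))
        (f (hbrk a (zs ! j) # z # omit j zs)))
      = koszul (fst a * sdg z) (\<Sum>j<length zs. koszul (sdg (zs ! j) * (\<Sum>l<j. sdg (zs ! l)))
        (f (z # hbrk a (zs ! j) # omit j zs)))"
    unfolding koszul_sum by (intro sum.cong) auto
  also have "\<dots> = koszul (fst a * sdg z) (lie_sum a (\<lambda>ws. f (z # ws)) zs)"
    using Cons.IH[OF symmetric_form_contract[OF Cons.prems(1), of z]] Cons.prems by simp
  finally show ?case
    unfolding length_Cons sum.lessThan_Suc_shift by simp
qed simp

text \<open>The pairs containing the first argument form its Lie sum. In the other pairs, both members and their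
  bracket pass \<open>z\<close>; since the bracket has odd degree relative to the pair, a single \<open>sdg z\<close> remains.\<close>
lemma bracket_sum_Cons:
  assumes f: "symmetric_form f" and z: "hom z" and zs: "homs zs"
  shows "bracket_sum f (z # zs) =
    koszul (fst z) (lie_sum z f zs) + koszul (sdg z) (bracket_sum (\<lambda>ws. f (z # ws)) zs)"
proof -
  have "koszul (sdg (zs ! i) * (sdg z + r) + sdg (zs ! j) * (sdg z + t) + fst (zs ! i))
        (f (hbrk (zs ! i) (zs ! j) # z # omit i (omit j zs)))
      = koszul (sdg z) (koszul (sdg (zs ! i) * r + sdg (zs ! j) * t + fst (zs ! i))
        (f (z # hbrk (zs ! i) (zs ! j) # omit i (omit j zs))))"
    if "i < j" "j < length zs" for i j r t
  proof -
    have "hom (zs ! i)" "hom (zs ! j)" "homs (omit i (omit j zs))"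
      using zs that by (auto intro: homs_nth list_all_omit)
    then show ?thesis
      using form_swap[OF f, of "hbrk (zs ! i) (zs ! j)" z "omit i (omit j zs)"] z
      by (auto simp: koszul_def)
  qed
  then have "(\<Sum>j<length zs. \<Sum>i<j.
        koszul (sdg (zs ! i) * (sdg z + (\<Sum>l<i. sdg (zs ! l)))
            + sdg (zs ! j) * (sdg z + (\<Sum>l\<in>{..<j} - {i}. sdg (zs ! l))) + fst (zs ! i))
          (f (hbrk (zs ! i) (zs ! j) # z # omit i (omit j zs))))
      = koszul (sdg z) (bracket_sum (\<lambda>ws. f (z # ws)) zs)"
    unfolding koszul_sum bracket_sum_def by (intro sum.cong) auto
  moreover have "(\<Sum>j<length zs. koszul (sdg (zs ! j) * (\<Sum>l<j. sdg (zs ! l)) + fst z)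
        (f (hbrk z (zs ! j) # omit j zs)))
      = koszul (fst z) (lie_sum z f zs)"
    unfolding lie_sum_moved_to_front[OF f z zs, symmetric] koszul_sum by (simp add: add.commute)
  ultimately show ?thesis
    unfolding bracket_sum_def length_Cons sum.lessThan_Suc_shift sum_lessThan_Suc_minus_0
      sum_lessThan_Suc_minus_Suc
    by (simp add: sum.lessThan_Suc_shift sum_lessThan_Suc_minus_0
      sum_lessThan_Suc_minus_Suc sum.distrib del: sum.lessThan_Suc)
qed

lemma cartan_dif_explicit:
  assumes "symmetric_form f" "homs zs"
  shows "cartan_dif n f zs =
    mdif M (f zs) + koszul n (internal_sum f zs)
    + (action_sum n f zs - koszul n (bracket_sum f zs)) + koszul n (f (hcrv # zs))"
  using assms
proof (induction zs arbitrary: n f)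
  case Nil
  then show ?case by (simp add: internal_sum_def action_sum_def bracket_sum_def)
next
  case (Cons z zs)
  note f = Cons.prems(1)
  have z: "hom z" and zs: "homs zs" using Cons.prems by simp_all
  have swap: "f (hcrv # z # zs) = koszul (sdg z) (f (z # hcrv # zs))"
    using form_swap[OF f, of hcrv z zs] z zs by simp
  have IH: "cartan_dif (n + sdg z) (\<lambda>ws. f (z # ws)) zs =
      mdif M (f (z # zs)) + koszul (n + sdg z) (internal_sum (\<lambda>ws. f (z # ws)) zs)
      + (action_sum (n + sdg z) (\<lambda>ws. f (z # ws)) zs
         - koszul (n + sdg z) (bracket_sum (\<lambda>ws. f (z # ws)) zs))
      + koszul (n + sdg z) (f (z # hcrv # zs))"
    by (rule Cons.IH[OF symmetric_form_contract[OF f z] zs])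
  show ?case
    unfolding cartan_dif.simps IH lie_der_def internal_sum_Cons action_sum_Cons
      bracket_sum_Cons[OF f z zs] swap
    by (cases "even n"; cases "even (fst z)"; simp add: koszul_def)
qed

end

section \<open>Extension to inhomogeneous arguments\<close>

lemma length_listset: "xs \<in> listset As \<Longrightarrow> length xs = length As"
  by (induction As arbitrary: xs) (auto simp: set_Cons_def)

context graded_space
begin

lemma is_decomposition_component: "is_decomposition gr v (component gr v)"
  unfolding component_def using direct_sum by (rule theI')

lemma component_mem: "component gr v k \<in> gr k"
  using is_decomposition_component unfolding is_decomposition_def by blast

lemma finite_degrees: "finite (degrees gr v)"
  using is_decomposition_component unfolding is_decomposition_def degrees_def by blast

lemma sum_components:
  assumes "finite K" "degrees gr v \<subseteq> K"
  shows "(\<Sum>k\<in>K. component gr v k) = v"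
proof -
  have "v = (\<Sum>k\<in>degrees gr v. component gr v k)"
    using is_decomposition_component unfolding is_decomposition_def degrees_def by blast
  also have "\<dots> = (\<Sum>k\<in>K. component gr v k)"
    using assms by (intro sum.mono_neutral_left) (auto simp: degrees_def)
  finally show ?thesis ..
qed

lemma component_lincomb:
  "component gr (scale c u + v) = (\<lambda>k. scale c (component gr u k) + component gr v k)"
  (is "_ = ?w")
proof -
  let ?K = "degrees gr u \<union> degrees gr v"
  have sub: "{k. ?w k \<noteq> 0} \<subseteq> ?K"
    by (auto simp: degrees_def)
  have "(\<Sum>k | ?w k \<noteq> 0. ?w k) = (\<Sum>k\<in>?K. ?w k)"
    using sub finite_degrees by (intro sum.mono_neutral_left) auto
  also have "\<dots> = scale c u + v"
    using finite_degrees by (simp add: sum.distrib sum_components flip: scale_sum_right)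
  finally have "is_decomposition gr (scale c u + v) ?w"
    using component_mem subspace_gr subspace_add subspace_scale
      finite_subset[OF sub] finite_degrees
    unfolding is_decomposition_def by auto
  then show ?thesis
    unfolding component_def using direct_sum by (intro the1_equality)
qed

end

lemma extend_Nil: "extend A \<phi> [] = \<phi> [] []"
  by (simp add: extend_def)

text \<open>Splitting the arguments one at a time makes induction on the argument list possible.\<close>
lemma extend_Cons:
  "extend A \<phi> (x # xs) = (\<Sum>k\<in>degrees (gr A) x.
     extend A (\<lambda>ks ys. \<phi> (k # ks) (component (gr A) x k # ys)) xs)"
proof -
  let ?K = "degrees (gr A) x" and ?L = "listset (map (degrees (gr A)) xs)"
  have "set_Cons ?K ?L = (\<lambda>(k, ks). k # ks) ` (?K \<times> ?L)"
    by (auto simp: set_Cons_def)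
  moreover have "inj_on (\<lambda>(k, ks). k # ks) (?K \<times> ?L)"
    by (auto simp: inj_on_def)
  ultimately show ?thesis
    by (simp add: extend_def sum.reindex sum.cartesian_product case_prod_unfold)
qed

lemma extend_cong:
  assumes "\<And>ks ys. length ks = length xs \<Longrightarrow> length ys = length xs \<Longrightarrow> \<phi> ks ys = \<psi> ks ys"
  shows "extend A \<phi> xs = extend A \<psi> xs"
  unfolding extend_def using assms by (intro sum.cong) (auto dest: length_listset)

lemma extend_add: "extend A (\<lambda>ks ys. \<phi> ks ys + \<psi> ks ys) xs = extend A \<phi> xs + extend A \<psi> xs"
  by (simp add: extend_def sum.distrib)

lemma extend_zero: "extend A (\<lambda>ks ys. 0) xs = 0"
  by (simp add: extend_def)

context cdg_module
begin

definition extend_form :: "((int \<times> 'a) list \<Rightarrow> 'm) \<Rightarrow> 'a list \<Rightarrow> 'm" where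
  "extend_form f = extend A (\<lambda>ks ys. f (zip ks ys))"

lemma extend_form_Nil [simp]: "extend_form f [] = f []"
  by (simp add: extend_form_def extend_Nil)

lemma extend_form_Cons:
  "extend_form f (x # xs) =
     (\<Sum>k\<in>degrees (gr A) x. extend_form (\<lambda>zs. f ((k, component (gr A) x k) # zs)) xs)"
  by (simp add: extend_form_def extend_Cons)

lemma extend_form_lincomb:
  "extend_form (\<lambda>zs. mscl M c (f zs) + g zs) xs = mscl M c (extend_form f xs) + extend_form g xs"
  by (simp add: extend_form_def extend_def sum.distrib M.scale_sum_right)

lemma extend_form_koszul: "extend_form (\<lambda>zs. koszul k (f zs)) xs = koszul k (extend_form f xs)"
  by (simp add: extend_form_def extend_def koszul_sum)

lemma hom_component: "hom (k, component (gr A) x k)"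
  by (simp add: hom_def component_mem)

lemma extend_form_cong:
  assumes "\<And>zs. homs zs \<Longrightarrow> length zs = length xs \<Longrightarrow> f zs = g zs"
  shows "extend_form f xs = extend_form g xs"
  using assms
proof (induction xs arbitrary: f g)
  case (Cons x xs)
  then show ?case
    unfolding extend_form_Cons by (intro sum.cong Cons.IH) (auto simp: hom_component)
qed simp

lemma extend_form_zero:
  assumes "\<And>zs. homs zs \<Longrightarrow> length zs = length xs \<Longrightarrow> f zs = 0"
  shows "extend_form f xs = 0"
  using extend_form_cong[of xs f "\<lambda>_. 0"] assms by (simp add: extend_form_def extend_zero)

text \<open>Absent components contribute \<open>0\<close>, so the components of several elements can be taken over one
  common set of degrees.\<close>
lemma extend_form_Cons_superset:
  assumes "symmetric_form f" "finite K" "degrees (gr A) x \<subseteq> K"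
  shows "extend_form f (x # xs) = (\<Sum>k\<in>K. extend_form (\<lambda>zs. f ((k, component (gr A) x k) # zs)) xs)"
  unfolding extend_form_Cons
  using assms form_zero
  by (intro sum.mono_neutral_left) (auto simp: degrees_def intro!: extend_form_zero)

lemma extend_form_Cons_lincomb:
  assumes f: "symmetric_form f"
  shows "extend_form f ((scl A c u + v) # xs) = mscl M c (extend_form f (u # xs)) + extend_form f (v # xs)"
proof -
  let ?K = "degrees (gr A) u \<union> degrees (gr A) v \<union> degrees (gr A) (scl A c u + v)"
  let ?c = "component (gr A)"
  have K: "finite ?K" "degrees (gr A) u \<subseteq> ?K" "degrees (gr A) v \<subseteq> ?K"
    "degrees (gr A) (scl A c u + v) \<subseteq> ?K"
    using finite_degrees by auto
  have "extend_form (\<lambda>zs. f ((k, ?c (scl A c u + v) k) # zs)) xs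
      = mscl M c (extend_form (\<lambda>zs. f ((k, ?c u k) # zs)) xs) + extend_form (\<lambda>zs. f ((k, ?c v k) # zs)) xs" for k
    unfolding extend_form_lincomb[symmetric] component_lincomb
    by (intro extend_form_cong form_lincomb[OF f] component_mem)
  then show ?thesis
    unfolding extend_form_Cons_superset[OF f K(1,2)] extend_form_Cons_superset[OF f K(1,3)]
      extend_form_Cons_superset[OF f K(1,4)]
    by (simp only: sum.distrib M.scale_sum_right)
qed

lemma extend_form_update_lincomb:
  assumes "symmetric_form f" "i < length xs"
  shows "extend_form f (xs[i := scl A c u + v]) = mscl M c (extend_form f (xs[i := u])) + extend_form f (xs[i := v])"
  using assms
proof (induction xs arbitrary: f i)
  case (Cons x xs)
  show ?case
  proof (cases i)
    case 0
    then show ?thesis by (simp add: extend_form_Cons_lincomb Cons.prems)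
  next
    case (Suc j)
    have "extend_form (\<lambda>zs. f (z # zs)) (xs[j := scl A c u + v])
        = mscl M c (extend_form (\<lambda>zs. f (z # zs)) (xs[j := u])) + extend_form (\<lambda>zs. f (z # zs)) (xs[j := v])"
      if "hom z" for z
      using Cons.IH[OF symmetric_form_contract[OF Cons.prems(1) that], of j] Cons.prems Suc by simp
    then show ?thesis
      by (simp add: Suc extend_form_Cons hom_component sum.distrib M.scale_sum_right)
  qed
qed simp

lemma multilinear_extend_form:
  assumes "symmetric_form f"
  shows "multilinear A M p (extend_form f)"
proof -
  have "Vector_Spaces.linear (scl A) (mscl M) (\<lambda>v. extend_form f (xs[i := v]))" if "i < length xs" for xs i
  proof -
    note lincomb = extend_form_update_lincomb[OF assms that]
    have zero: "extend_form f (xs[i := 0]) = 0"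
      using lincomb[of 1 0 0] by simp
    show ?thesis
      unfolding Vector_Spaces.linear_iff
      using lincomb[of 1] lincomb[of _ _ 0] zero vector_space_axioms M.vector_space_axioms by simp
  qed
  then show ?thesis
    unfolding multilinear_def by simp
qed

text \<open>For \<open>snd z = 0\<close> the left-hand side is an empty sum, while the right-hand side vanishes by linearity.\<close>
lemma extend_form_contract:
  assumes f: "symmetric_form f" and z: "hom z"
  shows "extend_form f (snd z # xs) = extend_form (\<lambda>zs. f (z # zs)) xs"
proof -
  have comp: "component (gr A) (snd z) = (\<lambda>i. if i = fst z then snd z else 0)"
    using z component_homogeneous unfolding hom_def by blast
  then have "degrees (gr A) (snd z) \<subseteq> {fst z}"
    by (auto simp: degrees_def)
  from extend_form_Cons_superset[OF f _ this] comp show ?thesis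
    by simp
qed

lemma extend_form_homs:
  assumes "symmetric_form f" "homs zs"
  shows "extend_form f (map snd zs) = f zs"
  using assms
proof (induction zs arbitrary: f)
  case (Cons z zs)
  then show ?case
    using Cons.IH[OF symmetric_form_contract[OF Cons.prems(1), of z]]
    by (simp add: extend_form_contract)
qed simp

lemma extend_form_swap:
  assumes f: "symmetric_form f" and y: "hom y" and z: "hom z"
  shows "extend_form f (us @ snd y # snd z # vs) = koszul (sdg y * sdg z) (extend_form f (us @ snd z # snd y # vs))"
  using f
proof (induction us arbitrary: f)
  case Nil
  note f = Nil.prems
  have "extend_form (\<lambda>zs. f (y # z # zs)) vs = koszul (sdg y * sdg z) (extend_form (\<lambda>zs. f (z # y # zs)) vs)"
    unfolding extend_form_koszul[symmetric] using form_swap[OF f y z] by (intro extend_form_cong)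
  then show ?case
    using extend_form_contract[OF f y] extend_form_contract[OF f z]
      extend_form_contract[OF symmetric_form_contract[OF f y] z]
      extend_form_contract[OF symmetric_form_contract[OF f z] y] by simp
next
  case (Cons u us)
  have "extend_form (\<lambda>zs. f ((k, component (gr A) u k) # zs)) (us @ snd y # snd z # vs)
      = koszul (sdg y * sdg z) (extend_form (\<lambda>zs. f ((k, component (gr A) u k) # zs)) (us @ snd z # snd y # vs))" for k
    by (rule Cons.IH[OF symmetric_form_contract[OF Cons.prems hom_component]])
  then show ?case
    unfolding append_Cons extend_form_Cons koszul_sum by simp
qed

lemma multilinear_eq_extend_form:
  assumes "multilinear A M (length xs) g"
  shows "g xs = extend_form (\<lambda>zs. g (map snd zs)) xs"
  using assms
proof (induction xs arbitrary: g)
  case (Cons x xs)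
  have tail: "multilinear A M (length xs) (\<lambda>ys. g (y # ys))" for y
    unfolding multilinear_def
  proof (intro allI impI)
    fix ys :: "'a list" and i assume "length ys = length xs \<and> i < length xs"
    then show "Vector_Spaces.linear (scl A) (mscl M) (\<lambda>v. g (y # ys[i := v]))"
      using Cons.prems[unfolded multilinear_def, rule_format, of "y # ys" "Suc i"] by simp
  qed
  have "Vector_Spaces.linear (scl A) (mscl M) (\<lambda>v. g (v # xs))"
    using Cons.prems[unfolded multilinear_def, rule_format, of "x # xs" 0] by simp
  then have "g ((\<Sum>k\<in>degrees (gr A) x. component (gr A) x k) # xs)
      = (\<Sum>k\<in>degrees (gr A) x. g (component (gr A) x k # xs))"
    unfolding linear_iff_module_hom by (rule module_hom.sum)
  then have "g (x # xs) = (\<Sum>k\<in>degrees (gr A) x. g (component (gr A) x k # xs))"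
    using sum_components[OF finite_degrees subset_refl] by simp
  also have "\<dots> = (\<Sum>k\<in>degrees (gr A) x. extend_form (\<lambda>zs. g (component (gr A) x k # map snd zs)) xs)"
    using Cons.IH[OF tail] by simp
  finally show ?case
    by (simp add: extend_form_Cons)
qed simp

section \<open>The total differential\<close>

text \<open>The components of total degree \<open>n\<close> have pairwise different numbers of arguments, so that they
  form a single function on lists.\<close>
definition assembled :: "int \<Rightarrow> ('a, 'm) cochain_family \<Rightarrow> (int \<times> 'a) list \<Rightarrow> 'm" where
  "assembled n F zs = F (length zs) (n - int (length zs)) (map snd zs)"

lemma homs_iff: "homs zs \<longleftrightarrow> homogeneous A (map fst zs) (map snd zs)"
  by (simp add: homogeneous_def list_all2_map1 list_all2_map2 list_all2_same hom_def list_all_iff)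

lemma symmetric_form_assembled:
  assumes F: "\<And>p k. F p k \<in> cochains A M p k"
  shows "symmetric_form (assembled n F)"
  unfolding symmetric_form_def
proof (intro conjI allI impI)
  fix k a b c and zs :: "(int \<times> 'a) list"
  let ?p = "Suc (length zs)"
  have "multilinear A M ?p (F ?p (n - int ?p))"
    using F by (simp add: cochains_def)
  from this[unfolded multilinear_def, rule_format, of "0 # map snd zs" 0]
  have "Vector_Spaces.linear (scl A) (mscl M) (\<lambda>v. F ?p (n - int ?p) (v # map snd zs))"
    by simp
  then show "assembled n F ((k, scl A c a + b) # zs)
      = mscl M c (assembled n F ((k, a) # zs)) + assembled n F ((k, b) # zs)"
    unfolding Vector_Spaces.linear_iff assembled_def by simp
next
  fix us vs :: "(int \<times> 'a) list" and y z
  assume "hom y" "hom z"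
  let ?p = "Suc (Suc (length us + length vs))"
  have "graded_symmetric A M (F ?p (n - int ?p))"
    using F by (simp add: cochains_def)
  then have "F ?p (n - int ?p) (map snd us @ [snd y, snd z] @ map snd vs)
      = koszul (sdg y * sdg z) (F ?p (n - int ?p) (map snd us @ [snd z, snd y] @ map snd vs))"
    using \<open>hom y\<close> \<open>hom z\<close> unfolding graded_symmetric_def hom_def mscl_ksign by blast
  then show "assembled n F (us @ y # z # vs)
      = koszul (sdg y * sdg z) (assembled n F (us @ z # y # vs))"
    unfolding assembled_def by simp
qed

lemma form_degree_assembled:
  assumes F: "\<And>p k. F p k \<in> cochains A M p k"
  shows "form_degree n (assembled n F)"
  unfolding form_degree_def
proof (intro allI impI)
  fix zs assume "homs zs"
  then have "assembled n F zs \<in> mgr M (n - int (length zs) + sum_list (map fst zs))"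
    using F[of "length zs" "n - int (length zs)"] unfolding cochains_def assembled_def homs_iff by auto
  moreover have "sum_list (map sdg zs) = sum_list (map fst zs) - int (length zs)"
    by (induction zs) auto
  ultimately show "assembled n F zs \<in> mgr M (n + sum_list (map sdg zs))"
    by (simp add: add_ac diff_add_eq add_diff_eq)
qed

lemma d_int_extend_form:
  assumes "\<And>zs. length zs = length xs \<Longrightarrow> g (map snd zs) = f zs"
  shows "d_int A M n g xs = extend_form (\<lambda>zs. mdif M (f zs) + koszul n (internal_sum f zs)) xs"
  unfolding d_int_def extend_form_def
proof (rule extend_cong)
  fix ks :: "int list" and ys :: "'a list"
  assume len: "length ks = length xs" "length ys = length xs"
  let ?zs = "zip ks ys"
  have "g ys = f ?zs"
    using assms[of ?zs] len by simp
  moreover have "g (ys[i := dif A (ys ! i)]) = f (?zs[i := hdif (?zs ! i)])" if "i < length ys" for i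
    using assms[of "?zs[i := hdif (?zs ! i)]"] len that by (simp add: map_update)
  ultimately show "mdif M (g ys) + mscl M (ksign n)
      (\<Sum>i<length ys. mscl M (ksign (\<Sum>l<i. sdeg ks l)) (g (ys[i := dif A (ys ! i)])))
    = mdif M (f ?zs) + koszul n (internal_sum f ?zs)"
    unfolding mscl_ksign internal_sum_def using len by (simp add: sdeg_def)
qed

lemma ksign_add: "ksign (k + l) = ksign k * ksign l"
  by (simp add: power_int_add)

lemma d_Ch_extend_form:
  assumes "\<And>zs. Suc (length zs) = length xs \<Longrightarrow> g (map snd zs) = f zs"
  shows "d_Ch A M n g xs = extend_form (\<lambda>zs. action_sum n f zs - koszul n (bracket_sum f zs)) xs"
  unfolding d_Ch_def extend_form_def
proof (rule extend_cong)
  fix ks :: "int list" and ys :: "'a list"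
  assume len: "length ks = length xs" "length ys = length xs"
  let ?zs = "zip ks ys"
  have omit: "g (omit i ys) = f (omit i ?zs)" if "i < length ys" for i
    using assms[of "omit i ?zs"] len that by (simp add: map_omit length_omit)
  have brk: "g (brk A (ys ! i) (ys ! j) # omit i (omit j ys))
      = f (hbrk (?zs ! i) (?zs ! j) # omit i (omit j ?zs))" if "i < j" "j < length ys" for i j
    using assms[of "hbrk (?zs ! i) (?zs ! j) # omit i (omit j ?zs)"] len that
    by (simp add: map_omit length_omit)
  have "(\<Sum>i<length ys. mscl M (ksign (n * sdeg ks i) * eta1 ks i) (act M (ys ! i) (g (omit i ys))))
      = action_sum n f ?zs"
    unfolding action_sum_def eta1_def ksign_add[symmetric] mscl_ksign
    using len by (intro sum.cong) (auto simp: sdeg_def omit)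
  moreover have "(\<Sum>j<length ys. \<Sum>i<j. mscl M (eta2 ks i j * ksign (ks ! i))
        (g (brk A (ys ! i) (ys ! j) # omit i (omit j ys)))) = bracket_sum f ?zs"
    unfolding bracket_sum_def eta2_def ksign_add[symmetric] mscl_ksign
    using len by (intro sum.cong) (auto simp: sdeg_def brk)
  ultimately show "(\<Sum>i<length ys. mscl M (ksign (n * sdeg ks i) * eta1 ks i) (act M (ys ! i) (g (omit i ys))))
    - mscl M (ksign n) (\<Sum>j<length ys. \<Sum>i<j. mscl M (eta2 ks i j * ksign (ks ! i))
        (g (brk A (ys ! i) (ys ! j) # omit i (omit j ys))))
    = action_sum n f ?zs - koszul n (bracket_sum f ?zs)"
    by (simp only: mscl_ksign)
qed

lemma d_crv_extend_form:
  assumes "multilinear A M (Suc (length xs)) g"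
    and "\<And>zs. length zs = Suc (length xs) \<Longrightarrow> g (map snd zs) = f zs"
  shows "d_crv A M n g xs = extend_form (\<lambda>zs. koszul n (f (hcrv # zs))) xs"
proof -
  have "multilinear A M (length xs) (\<lambda>ys. g (crv A # ys))"
    unfolding multilinear_def
  proof (intro allI impI)
    fix ys :: "'a list" and i assume "length ys = length xs \<and> i < length xs"
    then show "Vector_Spaces.linear (scl A) (mscl M) (\<lambda>v. g (crv A # ys[i := v]))"
      using assms(1)[unfolded multilinear_def, rule_format, of "crv A # ys" "Suc i"] by simp
  qed
  from multilinear_eq_extend_form[OF this]
  have "g (crv A # xs) = extend_form (\<lambda>zs. f (hcrv # zs)) xs"
    using assms(2)[of "hcrv # _"] by (auto intro!: extend_form_cong)
  then show ?thesis
    unfolding d_crv_def mscl_ksign extend_form_koszul by simp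
qed

lemma extend_form_add: "extend_form (\<lambda>zs. f zs + g zs) xs = extend_form f xs + extend_form g xs"
  by (simp add: extend_form_def extend_add)

text \<open>All three differentials entering the component \<open>(p, k)\<close> are applied to components of total degree
  \<open>p + k - 1\<close>, hence to the same assembled form.\<close>
lemma D_extend_form:
  assumes F: "\<And>p k. F p k \<in> cochains A M p k"
  shows "D A M F p k = (\<lambda>xs. if length xs = p
    then extend_form (cartan_dif (int p + k - 1) (assembled (int p + k - 1) F)) xs else 0)"
proof
  fix xs
  define n where "n = int p + k - 1"
  let ?f = "assembled n F"
  \<comment> \<open>Cochains vanish off their own length, which settles the lists of length other than \<open>p\<close>.\<close>
  have off: "F q l ys = 0" if "length ys \<noteq> q" for q l ys
    using F[of q l] that by (simp add: cochains_def)
  show "D A M F p k xs = (if length xs = p then extend_form (cartan_dif n ?f) xs else 0)"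
  proof (cases "length xs = p")
    case True
    have int: "d_int A M (int p + (k - 1)) (F p (k - 1)) xs
        = extend_form (\<lambda>zs. mdif M (?f zs) + koszul n (internal_sum ?f zs)) xs"
      using True by (subst d_int_extend_form[of xs _ ?f])
        (simp_all add: assembled_def n_def algebra_simps)
    have Ch: "(case p of 0 \<Rightarrow> 0 | Suc q \<Rightarrow> d_Ch A M (int q + k) (F q k) xs)
        = extend_form (\<lambda>zs. action_sum n ?f zs - koszul n (bracket_sum ?f zs)) xs"
    proof (cases p)
      case 0
      then show ?thesis
        using True by (simp add: action_sum_def bracket_sum_def)
    next
      case (Suc q)
      then have "d_Ch A M (int q + k) (F q k) xs
          = extend_form (\<lambda>zs. action_sum (int q + k) ?f zs - koszul (int q + k) (bracket_sum ?f zs)) xs"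
        using True by (intro d_Ch_extend_form) (simp add: assembled_def n_def)
      then show ?thesis
        using Suc by (simp add: n_def)
    qed
    have crv: "d_crv A M (int (p + 1) + (k - 2)) (F (p + 1) (k - 2)) xs
        = extend_form (\<lambda>zs. koszul n (?f (hcrv # zs))) xs"
    proof -
      have "d_crv A M (int (p + 1) + (k - 2)) (F (p + 1) (k - 2)) xs
        = extend_form (\<lambda>zs. koszul (int (p + 1) + (k - 2)) (?f (hcrv # zs))) xs"
        using True F[of "Suc p" "k - 2"]
        by (intro d_crv_extend_form) (simp_all add: assembled_def n_def cochains_def algebra_simps)
      then show ?thesis
        by (simp add: n_def algebra_simps)
    qed
    have "D A M F p k xs = extend_form (\<lambda>zs. mdif M (?f zs) + koszul n (internal_sum ?f zs)
        + (action_sum n ?f zs - koszul n (bracket_sum ?f zs)) + koszul n (?f (hcrv # zs))) xs"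
      unfolding D_def D1_def D2_def int Ch crv extend_form_add by simp
    also have "\<dots> = extend_form (cartan_dif n ?f) xs"
      using cartan_dif_explicit[OF symmetric_form_assembled[OF F], of _ n n]
      by (intro extend_form_cong) simp
    finally show ?thesis
      using True by simp
  next
    case False
    have "d_int A M m (F p l) xs = 0" for m l
    proof -
      have "d_int A M m (F p l) xs = extend A (\<lambda>_ _. 0) xs"
        unfolding d_int_def
        by (rule extend_cong) (use False in \<open>simp add: off linear_simps\<close>)
      then show ?thesis by (simp add: extend_zero)
    qed
    moreover have "d_Ch A M m (F q l) xs = 0" if "p = Suc q" for m q l
    proof -
      have "d_Ch A M m (F q l) xs = extend A (\<lambda>_ _. 0) xs"
        unfolding d_Ch_def
        by (rule extend_cong) (use False that in \<open>simp add: off linear_simps length_omit\<close>)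
      then show ?thesis by (simp add: extend_zero)
    qed
    ultimately show ?thesis
      using False by (simp add: D_def D1_def D2_def d_crv_def off split: nat.split)
  qed
qed

lemma extend_form_cochain:
  assumes f: "symmetric_form f" "form_degree (int p + k) f"
  shows "(\<lambda>xs. if length xs = p then extend_form f xs else 0) \<in> cochains A M p k"
  unfolding cochains_def
proof (intro CollectI conjI allI impI)
  show "multilinear A M p (\<lambda>xs. if length xs = p then extend_form f xs else 0)"
    using multilinear_extend_form[OF f(1), of p] unfolding multilinear_def by simp
  show "graded_symmetric A M (\<lambda>xs. if length xs = p then extend_form f xs else 0)"
    unfolding graded_symmetric_def
  proof (intro allI impI)
    fix us vs x y i j assume "x \<in> gr A i \<and> y \<in> gr A j"
    then show "(if length (us @ [x, y] @ vs) = p then extend_form f (us @ [x, y] @ vs) else 0)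
      = mscl M (ksign ((i - 1) * (j - 1)))
          (if length (us @ [y, x] @ vs) = p then extend_form f (us @ [y, x] @ vs) else 0)"
      using extend_form_swap[OF f(1), of "(i, x)" "(j, y)" us vs] unfolding mscl_ksign hom_def by simp
  qed
next
  fix ks xs assume *: "length xs = p \<and> homogeneous A ks xs"
  then have "length ks = p"
    by (auto simp: homogeneous_def dest: list_all2_lengthD)
  with * have homs: "homs (zip ks xs)"
    by (simp add: homs_iff)
  have "sum_list (map sdg (zip ks xs)) = sum_list ks - int p"
    using * \<open>length ks = p\<close>
    by (simp add: sum_list_subtractf sum_list_triv)
  then have "f (zip ks xs) \<in> mgr M (k + sum_list ks)"
    using f(2)[unfolded form_degree_def, rule_format, OF homs] by (simp add: algebra_simps)
  then show "(if length xs = p then extend_form f xs else 0) \<in> mgr M (k + sum_list ks)"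
    using extend_form_homs[OF f(1) homs] * \<open>length ks = p\<close> by simp
qed simp

lemma D_cochains:
  assumes F: "\<And>p k. F p k \<in> cochains A M p k"
  shows "D A M F p k \<in> cochains A M p k"
proof -
  have "form_degree (int p + k) (cartan_dif (int p + k - 1) (assembled (int p + k - 1) F))"
    using form_degree_cartan_dif[OF form_degree_assembled[OF F], of "int p + k - 1"] by simp
  then show ?thesis
    unfolding D_extend_form[OF F]
    by (intro extend_form_cochain symmetric_form_cartan_dif symmetric_form_assembled F)
qed

lemma D_eq_zero:
  assumes "F p (k - 1) = (\<lambda>_. 0)" "\<And>q. p = Suc q \<Longrightarrow> F q k = (\<lambda>_. 0)" "F (p + 1) (k - 2) = (\<lambda>_. 0)"
  shows "D A M F p k = (\<lambda>_. 0)"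
  using assms by (auto simp: D_def D1_def D2_def d_int_def d_Ch_def d_crv_def extend_zero
      linear_simps fun_eq_iff split: nat.split)

text \<open>Each nonzero component of \<open>F\<close> reaches at most three components of \<open>D F\<close>, whence finite support.\<close>
lemma D_total_space:
  assumes F: "F \<in> total_space A M"
  shows "D A M F \<in> total_space A M"
proof -
  let ?S = "{(p, k). F p k \<noteq> (\<lambda>_. 0)}"
  have "(p, k) \<in> (\<lambda>(p, k). (p, k + 1)) ` ?S \<union> (\<lambda>(p, k). (p + 1, k)) ` ?S
      \<union> (\<lambda>(p, k). (p - 1, k + 2)) ` ?S" if "D A M F p k \<noteq> (\<lambda>_. 0)" for p k
  proof -
    have "F p (k - 1) \<noteq> (\<lambda>_. 0) \<or> (\<exists>q. p = Suc q \<and> F q k \<noteq> (\<lambda>_. 0))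
        \<or> F (p + 1) (k - 2) \<noteq> (\<lambda>_. 0)"
      using that D_eq_zero[of F p k] by metis
    then consider "(p, k - 1) \<in> ?S" | q where "p = Suc q" "(q, k) \<in> ?S" | "(p + 1, k - 2) \<in> ?S"
      by auto
    then show ?thesis
      by cases (force simp: image_iff)+
  qed
  then have "{(p, k). D A M F p k \<noteq> (\<lambda>_. 0)} \<subseteq> (\<lambda>(p, k). (p, k + 1)) ` ?S
      \<union> (\<lambda>(p, k). (p + 1, k)) ` ?S \<union> (\<lambda>(p, k). (p - 1, k + 2)) ` ?S"
    by blast
  moreover have "finite ?S"
    using F by (simp add: total_space_def)
  ultimately have "finite {(p, k). D A M F p k \<noteq> (\<lambda>_. 0)}"
    by (meson finite_Un finite_imageI finite_subset)
  then show ?thesis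
    using F D_cochains by (simp add: total_space_def)
qed

lemma D_total_degree_part:
  assumes "F \<in> total_degree_part A M n"
  shows "D A M F \<in> total_degree_part A M (n + 1)"
proof -
  have "D A M F p k = (\<lambda>_. 0)" if "int p + k \<noteq> n + 1" for p k
    using assms that by (intro D_eq_zero) (auto simp: total_degree_part_def)
  then show ?thesis
    using assms D_total_space by (simp add: total_degree_part_def)
qed

lemma D_square:
  assumes F: "\<And>p k. F p k \<in> cochains A M p k"
  shows "D A M (D A M F) = (\<lambda>p k xs. 0)"
proof (intro ext)
  fix p k xs
  let ?n = "int p + k - 1"
  let ?f = "assembled (?n - 1) F"
  have "assembled ?n (D A M F) zs = cartan_dif (?n - 1) ?f zs" if "homs zs" for zs
    unfolding assembled_def[of ?n] D_extend_form[OF F]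
    using extend_form_homs[OF symmetric_form_cartan_dif[OF symmetric_form_assembled[OF F]] that] by simp
  then have "cartan_dif ?n (assembled ?n (D A M F)) zs = 0" if "homs zs" for zs
    using cartan_dif_cong[of "assembled ?n (D A M F)" "cartan_dif (?n - 1) ?f" zs ?n]
      cartan_dif_square[OF symmetric_form_assembled[OF F] that, of "?n - 1" "?n - 1"] that by simp
  then show "D A M (D A M F) p k xs = 0"
    unfolding D_extend_form[OF D_cochains[OF F]] by (simp add: extend_form_zero)
qed

end

theorem lemma2p2p1:
  fixes A :: "'a::ab_group_add cdg_lie_data"
    and M :: "('a, 'm::ab_group_add) cdg_module_data"
  assumes "cdg_lie_algebra A" and "cdg_module A M"
  shows "(\<forall>F\<in>total_space A M. D A M F \<in> total_space A M)
    \<and> (\<forall>n. \<forall>F\<in>total_degree_part A M n. D A M F \<in> total_degree_part A M (n + 1))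
    \<and> (\<forall>F\<in>total_space A M. D A M (D A M F) = (\<lambda>p k xs. 0))"
proof -
  interpret cdg_module A M by fact
  show ?thesis
    using D_total_space D_total_degree_part D_square by (auto simp: total_space_def)
qed

end
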